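(* Let $A$ be a ring and let $G$ be a group. The following conditions are equivalent: (1) The group ring $A[G]$ is left self-injective. (2) $A$ is left self-injective and $G$ is a finite group.
   Context: Rings are associative with identity $1 \neq 0$, not necessarily commutative; $G$ is an arbitrary group. $A[G]$ denotes the group ring of $G$ with coefficients in $A$. A ring $B$ is left self-injective if $B$, regarded as a left module over itself, is an injective left $B$-module. *)

theory Defs
  imports "HOL-Algebra.Module"
begin

section \<open>Left modules over a not necessarily commutative ring\<close>

text \<open>
  The axioms are those of the locale \<^locale>\<open>module\<close>, except that the ring of scalars need not
  be commutative. As there, the fields \<^const>\<open>mult\<close> and \<^const>\<open>one\<close> of the module record play no role.
\<close>

locale left_module = R?: ring R + M?: abelian_group M
  for R :: "('r, 'x) ring_scheme" (structure) and M :: "('r, 'm, 'y) module_scheme" (structure) +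
  assumes smult_closed [simp, intro]:
      "\<lbrakk> a \<in> carrier R; x \<in> carrier M \<rbrakk> \<Longrightarrow> a \<odot>\<^bsub>M\<^esub> x \<in> carrier M"
    and smult_l_distr:
      "\<lbrakk> a \<in> carrier R; b \<in> carrier R; x \<in> carrier M \<rbrakk> \<Longrightarrow>
       (a \<oplus> b) \<odot>\<^bsub>M\<^esub> x = a \<odot>\<^bsub>M\<^esub> x \<oplus>\<^bsub>M\<^esub> b \<odot>\<^bsub>M\<^esub> x"
    and smult_r_distr:
      "\<lbrakk> a \<in> carrier R; x \<in> carrier M; y \<in> carrier M \<rbrakk> \<Longrightarrow>
       a \<odot>\<^bsub>M\<^esub> (x \<oplus>\<^bsub>M\<^esub> y) = a \<odot>\<^bsub>M\<^esub> x \<oplus>\<^bsub>M\<^esub> a \<odot>\<^bsub>M\<^esub> y"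
    and smult_assoc1:
      "\<lbrakk> a \<in> carrier R; b \<in> carrier R; x \<in> carrier M \<rbrakk> \<Longrightarrow>
       (a \<otimes> b) \<odot>\<^bsub>M\<^esub> x = a \<odot>\<^bsub>M\<^esub> (b \<odot>\<^bsub>M\<^esub> x)"
    and smult_one [simp]:
      "x \<in> carrier M \<Longrightarrow> \<one> \<odot>\<^bsub>M\<^esub> x = x"

definition left_module_hom ::
    "('r, 'x) ring_scheme \<Rightarrow> ('r, 'm, 'y) module_scheme \<Rightarrow> ('r, 'n, 'z) module_scheme \<Rightarrow> ('m \<Rightarrow> 'n) set"
  where "left_module_hom R M N =
    {h \<in> carrier M \<rightarrow> carrier N.
      (\<forall>x\<in>carrier M. \<forall>y\<in>carrier M. h (x \<oplus>\<^bsub>M\<^esub> y) = h x \<oplus>\<^bsub>N\<^esub> h y) \<and>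
      (\<forall>a\<in>carrier R. \<forall>x\<in>carrier M. h (a \<odot>\<^bsub>M\<^esub> x) = a \<odot>\<^bsub>N\<^esub> h x)}"

section \<open>Injective modules and self-injective rings\<close>

text \<open>
  \<open>injective_left_module TYPE('t) R Q\<close>: every homomorphism \<open>f : M \<rightarrow> Q\<close> extends along every
  injective homomorphism \<open>i : M \<rightarrow> N\<close>, where \<open>M\<close> and \<open>N\<close> range over all left \<open>R\<close>-modules whose
  underlying set is a set of elements of \<open>'t\<close>. Formulas of HOL cannot quantify over types, so the
  type (the universe) of the test modules is a parameter.
\<close>

definition injective_left_module ::
    "'t itself \<Rightarrow> ('r, 'x) ring_scheme \<Rightarrow> ('r, 'q, 'y) module_scheme \<Rightarrow> bool"
  where "injective_left_module (_ :: 't itself) R Q \<longleftrightarrow>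
    left_module R Q \<and>
    (\<forall>(M :: ('r, 't) module) (N :: ('r, 't) module).
      left_module R M \<longrightarrow> left_module R N \<longrightarrow>
      (\<forall>i \<in> left_module_hom R M N. inj_on i (carrier M) \<longrightarrow>
        (\<forall>f \<in> left_module_hom R M Q.
          \<exists>g \<in> left_module_hom R N Q. \<forall>x\<in>carrier M. g (i x) = f x)))"

definition regular_left_module :: "('r, 'x) ring_scheme \<Rightarrow> ('r, 'r) module"
  where "regular_left_module R =
    \<lparr>carrier = carrier R, mult = mult R, one = one R, zero = zero R, add = add R, smult = mult R\<rparr>"

text \<open>
  The universe of test modules is \<open>'r + 'u\<close>, with \<open>'u\<close> arbitrary. The summand \<open>'r\<close> makes it large
  enough to contain a copy of every left ideal of \<open>R\<close>, and every module living on the type \<open>'u\<close>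
  has a copy in it, so that a result holding for all \<open>'u\<close> speaks about modules of any size.
\<close>

definition left_self_injective :: "'u itself \<Rightarrow> ('r, 'x) ring_scheme \<Rightarrow> bool"
  where "left_self_injective (_ :: 'u itself) (R :: ('r, 'x) ring_scheme) \<longleftrightarrow>
    injective_left_module TYPE('r + 'u) R (regular_left_module R)"

section \<open>Group rings\<close>

text \<open>
  An element of the group ring is a finitely supported function from the group to the coefficient
  ring; outside the carrier of the group it is set to zero, so that equality of elements is
  equality of functions. The product is convolution.
\<close>

definition group_ring :: "('a, 'x) ring_scheme \<Rightarrow> ('g, 'y) monoid_scheme \<Rightarrow> ('g \<Rightarrow> 'a) ring"
  where "group_ring A G =
    \<lparr>carrier = {f. (\<forall>x\<in>carrier G. f x \<in> carrier A) \<and> (\<forall>x. x \<notin> carrier G \<longrightarrow> f x = \<zero>\<^bsub>A\<^esub>) \<and>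
                   finite {x. f x \<noteq> \<zero>\<^bsub>A\<^esub>}},
     mult = (\<lambda>f g x. if x \<in> carrier G
               then \<Oplus>\<^bsub>A\<^esub>y\<in>{y \<in> carrier G. f y \<noteq> \<zero>\<^bsub>A\<^esub>}. f y \<otimes>\<^bsub>A\<^esub> g (inv\<^bsub>G\<^esub> y \<otimes>\<^bsub>G\<^esub> x)
               else \<zero>\<^bsub>A\<^esub>),
     one = (\<lambda>x. if x = \<one>\<^bsub>G\<^esub> then \<one>\<^bsub>A\<^esub> else \<zero>\<^bsub>A\<^esub>),
     zero = (\<lambda>_. \<zero>\<^bsub>A\<^esub>),
     add = (\<lambda>f g x. f x \<oplus>\<^bsub>A\<^esub> g x)\<rparr>"

end

theory Submission
  imports Defs "HOL-Algebra.Generated_Groups"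
begin

text \<open>
  By Baer's criterion, a ring \<open>R\<close> is left self-injective precisely when every homomorphism from a
  left ideal to \<open>R\<close> is right multiplication by an element of \<open>R\<close> (\<open>baer_criterion\<close>,
  \<open>left_self_injective_imp_baer\<close>). This also makes the notion independent of the universe of
  test modules.

  If \<open>G\<close> is finite, \<open>A[G]\<close> is the left module coinduced from \<open>A\<close>: homomorphisms \<open>M \<rightarrow> A[G]\<close> correspond
  to \<open>A\<close>-linear maps \<open>M \<rightarrow> A\<close> by taking the coefficient at the identity, so injectivity of \<open>A\<close>
  passes to \<open>A[G]\<close> (\<open>group_ring_injective\<close>). Conversely, a homomorphism \<open>J \<rightarrow> A\<close> on a left ideal of \<open>A\<close>
  extends coefficientwise to \<open>J[G] \<rightarrow> A[G]\<close>, so self-injectivity of \<open>A[G]\<close> passes to \<open>A\<close>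
  (\<open>baer_coefficients\<close>).

  The finiteness of \<open>G\<close> takes two applications of Baer's condition. If finitely many elements \<open>h\<close>
  generate an infinite subgroup, the elements \<open>1 - h\<close> have no common nonzero left annihilator; over
  a self-injective ring they then generate the unit right ideal, although they lie in the
  augmentation ideal (\<open>baer_imp_locally_finite\<close>). So \<open>G\<close> is locally finite. If \<open>G\<close> were still infinite,
  it would contain the union of a strictly increasing sequence of finite subgroups. Such a union has
  more than one end: it carries a function that every translation changes in finitely many places
  only, but that is not constant outside a finite set. Right multiplication by this function is a
  homomorphism from a left ideal that no element of \<open>A[G]\<close> can represent (\<open>baer_imp_finite\<close>).
\<close>

section \<open>Left ideals and Baer's criterion\<close>

lemma (in abelian_group) eq_if_minus_eq_zero:
  assumes "x \<ominus> y = \<zero>" "x \<in> carrier G" "y \<in> carrier G" shows "x = y"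
  using assms by (metis a_inv_closed a_minus_def minus_equality minus_minus)

definition left_ideal :: "('r, 'x) ring_scheme \<Rightarrow> 'r set \<Rightarrow> bool"
  where "left_ideal R J \<longleftrightarrow> J \<subseteq> carrier R \<and> \<zero>\<^bsub>R\<^esub> \<in> J \<and>
    (\<forall>x\<in>J. \<forall>y\<in>J. x \<oplus>\<^bsub>R\<^esub> y \<in> J) \<and> (\<forall>a\<in>carrier R. \<forall>x\<in>J. a \<otimes>\<^bsub>R\<^esub> x \<in> J)"

text \<open>
  Baer's test for injectivity of \<open>R\<close> as a left module over itself. A homomorphism on all of \<open>R\<close> is
  right multiplication by the image of \<open>1\<close>, so extending \<open>f\<close> to \<open>R\<close> means finding that image. Unlike
  self-injectivity, the condition mentions no universe of test modules.
\<close>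

definition baer :: "('r, 'x) ring_scheme \<Rightarrow> bool"
  where "baer R \<longleftrightarrow> (\<forall>J f. left_ideal R J \<longrightarrow> f \<in> J \<rightarrow> carrier R \<longrightarrow>
    (\<forall>x\<in>J. \<forall>y\<in>J. f (x \<oplus>\<^bsub>R\<^esub> y) = f x \<oplus>\<^bsub>R\<^esub> f y) \<longrightarrow>
    (\<forall>a\<in>carrier R. \<forall>x\<in>J. f (a \<otimes>\<^bsub>R\<^esub> x) = a \<otimes>\<^bsub>R\<^esub> f x) \<longrightarrow>
    (\<exists>w\<in>carrier R. \<forall>x\<in>J. f x = x \<otimes>\<^bsub>R\<^esub> w))"

lemma baerD:
  assumes "baer R" "left_ideal R J" "\<And>x. x \<in> J \<Longrightarrow> f x \<in> carrier R"
    "\<And>x y. x \<in> J \<Longrightarrow> y \<in> J \<Longrightarrow> f (x \<oplus>\<^bsub>R\<^esub> y) = f x \<oplus>\<^bsub>R\<^esub> f y"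
    "\<And>a x. a \<in> carrier R \<Longrightarrow> x \<in> J \<Longrightarrow> f (a \<otimes>\<^bsub>R\<^esub> x) = a \<otimes>\<^bsub>R\<^esub> f x"
  obtains w where "w \<in> carrier R" "\<And>x. x \<in> J \<Longrightarrow> f x = x \<otimes>\<^bsub>R\<^esub> w"
proof -
  have "f \<in> J \<rightarrow> carrier R" using assms(3) by blast
  then have "\<exists>w\<in>carrier R. \<forall>x\<in>J. f x = x \<otimes>\<^bsub>R\<^esub> w"
    using assms(1,2,4,5) unfolding baer_def by blast
  then show thesis using that by blast
qed

lemma injective_left_moduleD:
  fixes M N :: "('r, 't) module"
  assumes "injective_left_module TYPE('t) R Q" "left_module R M" "left_module R N"
    and "i \<in> left_module_hom R M N" "inj_on i (carrier M)" "f \<in> left_module_hom R M Q"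
  shows "\<exists>g\<in>left_module_hom R N Q. \<forall>x\<in>carrier M. g (i x) = f x"
  using assms(1)[unfolded injective_left_module_def, THEN conjunct2, rule_format, OF assms(2-6)] .

context left_module
begin

lemma smult_l_null [simp]:
  assumes "x \<in> carrier M" shows "\<zero>\<^bsub>R\<^esub> \<odot>\<^bsub>M\<^esub> x = \<zero>\<^bsub>M\<^esub>"
proof -
  have "\<zero>\<^bsub>R\<^esub> \<odot>\<^bsub>M\<^esub> x \<oplus>\<^bsub>M\<^esub> \<zero>\<^bsub>R\<^esub> \<odot>\<^bsub>M\<^esub> x = \<zero>\<^bsub>R\<^esub> \<odot>\<^bsub>M\<^esub> x"
    using smult_l_distr[of "\<zero>\<^bsub>R\<^esub>" "\<zero>\<^bsub>R\<^esub>" x] assms by simp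
  then show ?thesis using assms by simp
qed

lemma smult_l_minus:
  assumes "x \<in> carrier M" "a \<in> carrier R" shows "(\<ominus>\<^bsub>R\<^esub> a) \<odot>\<^bsub>M\<^esub> x = \<ominus>\<^bsub>M\<^esub> (a \<odot>\<^bsub>M\<^esub> x)"
proof -
  have "(\<ominus>\<^bsub>R\<^esub> a) \<odot>\<^bsub>M\<^esub> x \<oplus>\<^bsub>M\<^esub> a \<odot>\<^bsub>M\<^esub> x = \<zero>\<^bsub>M\<^esub>"
    using smult_l_distr[of "\<ominus>\<^bsub>R\<^esub> a" a x] assms by (simp add: R.l_neg)
  then show ?thesis using assms by (simp add: M.minus_equality)
qed

lemma smult_minus_one:
  assumes "x \<in> carrier M" shows "(\<ominus>\<^bsub>R\<^esub> \<one>\<^bsub>R\<^esub>) \<odot>\<^bsub>M\<^esub> x = \<ominus>\<^bsub>M\<^esub> x"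
  using smult_l_minus[OF assms R.one_closed] assms by simp

end

lemma (in ring) left_ideal_minus:
  assumes "left_ideal R J" "x \<in> J" shows "\<ominus> x \<in> J"
proof -
  have "x \<in> carrier R" using assms unfolding left_ideal_def by blast
  then have "(\<ominus> \<one>) \<otimes> x = \<ominus> x" by (simp add: l_minus)
  moreover have "(\<ominus> \<one>) \<otimes> x \<in> J" using assms unfolding left_ideal_def by simp
  ultimately show ?thesis by simp
qed

lemma (in ring) left_ideal_carrier: "left_ideal R (carrier R)"
  unfolding left_ideal_def by simp

lemma (in ring) regular_left_module: "left_module R (regular_left_module R)"
proof -
  have "abelian_group (regular_left_module R)"
    by (rule abelian_groupI)
      (auto simp: regular_left_module_def a_ac intro: a_inv_closed r_neg l_neg)
  then show ?thesis
    by (intro left_module.intro left_module_axioms.intro ring_axioms)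
      (auto simp: regular_left_module_def l_distr r_distr m_assoc)
qed

text \<open>
  The test modules of self-injectivity have carriers in the type \<open>'r + 'u\<close>; left ideals enter that
  universe through the left summand.
\<close>

definition left_ideal_copy :: "('r, 'x) ring_scheme \<Rightarrow> 'r set \<Rightarrow> ('r, 'r + 'u) module"
  where "left_ideal_copy R J =
    \<lparr>carrier = Inl ` J, mult = undefined, one = undefined, zero = Inl \<zero>\<^bsub>R\<^esub>,
     add = (\<lambda>x y. Inl (projl x \<oplus>\<^bsub>R\<^esub> projl y)), smult = (\<lambda>a x. Inl (a \<otimes>\<^bsub>R\<^esub> projl x))\<rparr>"

lemma (in ring) left_ideal_copy_left_module:
  assumes J: "left_ideal R J" shows "left_module R (left_ideal_copy R J)"
proof -
  have sub: "x \<in> carrier R" if "x \<in> J" for x using J that unfolding left_ideal_def by blast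
  have cl: "\<zero> \<in> J" "\<And>x y. x \<in> J \<Longrightarrow> y \<in> J \<Longrightarrow> x \<oplus> y \<in> J"
    "\<And>a x. a \<in> carrier R \<Longrightarrow> x \<in> J \<Longrightarrow> a \<otimes> x \<in> J"
    using J unfolding left_ideal_def by auto
  have neg: "\<exists>y\<in>J. y \<oplus> x = \<zero>" "\<exists>y\<in>J. x \<oplus> y = \<zero>" if "x \<in> J" for x
    using left_ideal_minus[OF J that] l_neg[OF sub[OF that]] r_neg[OF sub[OF that]] by blast+
  have "abelian_group (left_ideal_copy R J)"
    by (rule abelian_groupI) (auto simp: left_ideal_copy_def cl sub a_ac neg)
  then show ?thesis
    by (intro left_module.intro left_module_axioms.intro ring_axioms)
      (auto simp: left_ideal_copy_def cl sub l_distr r_distr m_assoc)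
qed

lemma left_self_injective_imp_baer:
  fixes R :: "('r, 'x) ring_scheme"
  assumes inj: "left_self_injective TYPE('u) R"
  shows "baer R"
  unfolding baer_def
proof (intro allI impI)
  fix J f
  assume J: "left_ideal R J" and f: "f \<in> J \<rightarrow> carrier R"
    and add: "\<forall>x\<in>J. \<forall>y\<in>J. f (x \<oplus>\<^bsub>R\<^esub> y) = f x \<oplus>\<^bsub>R\<^esub> f y"
    and lin: "\<forall>a\<in>carrier R. \<forall>x\<in>J. f (a \<otimes>\<^bsub>R\<^esub> x) = a \<otimes>\<^bsub>R\<^esub> f x"
  have "left_module R (regular_left_module R)"
    using inj unfolding left_self_injective_def injective_left_module_def by blast
  then interpret ring R by (rule left_module.axioms)
  let ?M = "left_ideal_copy R J :: ('r, 'r + 'u) module"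
  let ?N = "left_ideal_copy R (carrier R) :: ('r, 'r + 'u) module"
  have sub: "x \<in> carrier R" if "x \<in> J" for x using J that unfolding left_ideal_def by blast
  have M: "left_module R ?M" and N: "left_module R ?N"
    using left_ideal_copy_left_module J left_ideal_carrier by blast+
  have i: "id \<in> left_module_hom R ?M ?N"
    by (auto simp: left_module_hom_def left_ideal_copy_def sub)
  have f': "f \<circ> projl \<in> left_module_hom R ?M (regular_left_module R)"
    using f add lin by (auto simp: left_module_hom_def left_ideal_copy_def regular_left_module_def)
  obtain g where g: "g \<in> left_module_hom R ?N (regular_left_module R)"
    and ext: "\<And>x. x \<in> carrier ?M \<Longrightarrow> g (id x) = (f \<circ> projl) x"
    using injective_left_moduleD[OF inj[unfolded left_self_injective_def] M N i inj_on_id f'] by blast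
  have one: "Inl \<one>\<^bsub>R\<^esub> \<in> carrier ?N" by (simp add: left_ideal_copy_def)
  have w: "g (Inl \<one>\<^bsub>R\<^esub>) \<in> carrier R"
    using g one by (auto simp: left_module_hom_def regular_left_module_def)
  have "f x = x \<otimes>\<^bsub>R\<^esub> g (Inl \<one>\<^bsub>R\<^esub>)" if x: "x \<in> J" for x
  proof -
    have "g (x \<odot>\<^bsub>?N\<^esub> Inl \<one>\<^bsub>R\<^esub>) = x \<otimes>\<^bsub>R\<^esub> g (Inl \<one>\<^bsub>R\<^esub>)"
      using g one sub[OF x] by (auto simp: left_module_hom_def regular_left_module_def)
    moreover have "g (Inl x) = f x" using ext[of "Inl x"] x by (auto simp: left_ideal_copy_def)
    ultimately show ?thesis using sub[OF x] by (simp add: left_ideal_copy_def)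
  qed
  then show "\<exists>w\<in>carrier R. \<forall>x\<in>J. f x = x \<otimes>\<^bsub>R\<^esub> w" using w by blast
qed

text \<open>
  Graphs of homomorphisms from submodules of \<open>N\<close> to \<open>R\<close>. For a relation that is itself a submodule,
  single-valuedness only has to be required at \<open>0\<close>; relations make unions of chains and the
  adjunction of one element easy to form.
\<close>

definition partial_hom_graph ::
    "('r, 'x) ring_scheme \<Rightarrow> ('r, 'm, 'y) module_scheme \<Rightarrow> ('m \<times> 'r) set \<Rightarrow> bool"
  where "partial_hom_graph R N \<Gamma> \<longleftrightarrow>
    \<Gamma> \<subseteq> carrier N \<times> carrier R \<and>
    (\<forall>x u y v. (x, u) \<in> \<Gamma> \<longrightarrow> (y, v) \<in> \<Gamma> \<longrightarrow> (x \<oplus>\<^bsub>N\<^esub> y, u \<oplus>\<^bsub>R\<^esub> v) \<in> \<Gamma>) \<and>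
    (\<forall>a x u. a \<in> carrier R \<longrightarrow> (x, u) \<in> \<Gamma> \<longrightarrow> (a \<odot>\<^bsub>N\<^esub> x, a \<otimes>\<^bsub>R\<^esub> u) \<in> \<Gamma>) \<and>
    (\<forall>u. (\<zero>\<^bsub>N\<^esub>, u) \<in> \<Gamma> \<longrightarrow> u = \<zero>\<^bsub>R\<^esub>)"

lemma partial_hom_graph_single_valued:
  assumes N: "left_module R N" and \<Gamma>: "partial_hom_graph R N \<Gamma>"
    and "(x, u) \<in> \<Gamma>" "(x, v) \<in> \<Gamma>"
  shows "u = v"
proof -
  interpret left_module R N by (rule N)
  have c: "x \<in> carrier N" "u \<in> carrier R" "v \<in> carrier R"
    using assms unfolding partial_hom_graph_def by auto
  have "(\<ominus>\<^bsub>R\<^esub> \<one>\<^bsub>R\<^esub> \<odot>\<^bsub>N\<^esub> x, \<ominus>\<^bsub>R\<^esub> \<one>\<^bsub>R\<^esub> \<otimes>\<^bsub>R\<^esub> v) \<in> \<Gamma>"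
    using assms unfolding partial_hom_graph_def by simp
  then have "(\<ominus>\<^bsub>N\<^esub> x, \<ominus>\<^bsub>R\<^esub> v) \<in> \<Gamma>" using c by (simp add: smult_minus_one R.l_minus)
  then have "(x \<oplus>\<^bsub>N\<^esub> \<ominus>\<^bsub>N\<^esub> x, u \<oplus>\<^bsub>R\<^esub> \<ominus>\<^bsub>R\<^esub> v) \<in> \<Gamma>"
    using assms unfolding partial_hom_graph_def by blast
  then have "u \<oplus>\<^bsub>R\<^esub> \<ominus>\<^bsub>R\<^esub> v = \<zero>\<^bsub>R\<^esub>"
    using \<Gamma> c unfolding partial_hom_graph_def by (simp add: M.r_neg)
  then show ?thesis using R.eq_if_minus_eq_zero[of u v] c unfolding a_minus_def by blast
qed

text \<open>
  The elements \<open>r\<close> with \<open>r n\<close> in the domain form a left ideal, on which \<open>r\<close> is sent to the value at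
  \<open>r n\<close>. By Baer's condition this is right multiplication by some \<open>w\<close>, and then \<open>n\<close> can be sent to
  \<open>w\<close>: this is consistent exactly because the two prescriptions agree on that left ideal.
\<close>

lemma partial_hom_graph_extend:
  assumes N: "left_module R N" and baer: "baer R" and \<Gamma>: "partial_hom_graph R N \<Gamma>"
    and ne: "\<Gamma> \<noteq> {}" and n: "n \<in> carrier N"
  shows "\<exists>\<Gamma>' w. partial_hom_graph R N \<Gamma>' \<and> \<Gamma> \<subseteq> \<Gamma>' \<and> (n, w) \<in> \<Gamma>'"
proof -
  interpret left_module R N by (rule N)
  have sub: "x \<in> carrier N" "u \<in> carrier R" if "(x, u) \<in> \<Gamma>" for x u
    using \<Gamma> that unfolding partial_hom_graph_def by auto
  have add: "(x \<oplus>\<^bsub>N\<^esub> y, u \<oplus>\<^bsub>R\<^esub> v) \<in> \<Gamma>" if "(x, u) \<in> \<Gamma>" "(y, v) \<in> \<Gamma>" for x u y v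
    using \<Gamma> that unfolding partial_hom_graph_def by auto
  have smult: "(a \<odot>\<^bsub>N\<^esub> x, a \<otimes>\<^bsub>R\<^esub> u) \<in> \<Gamma>" if "a \<in> carrier R" "(x, u) \<in> \<Gamma>" for a x u
    using \<Gamma> that unfolding partial_hom_graph_def by auto
  note uniq = partial_hom_graph_single_valued[OF N \<Gamma>]
  have zero: "(\<zero>\<^bsub>N\<^esub>, \<zero>\<^bsub>R\<^esub>) \<in> \<Gamma>"
  proof -
    obtain x u where xu: "(x, u) \<in> \<Gamma>" using ne by auto
    then show ?thesis using smult[of "\<zero>\<^bsub>R\<^esub>" x u] sub[OF xu] by simp
  qed
  define J where "J = {r \<in> carrier R. \<exists>u. (r \<odot>\<^bsub>N\<^esub> n, u) \<in> \<Gamma>}"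
  define f where "f r = (THE u. (r \<odot>\<^bsub>N\<^esub> n, u) \<in> \<Gamma>)" for r
  have f_eq: "f r = u" if "(r \<odot>\<^bsub>N\<^esub> n, u) \<in> \<Gamma>" for r u
    unfolding f_def using that uniq by blast
  have f_in: "(r \<odot>\<^bsub>N\<^esub> n, f r) \<in> \<Gamma>" and J_sub: "r \<in> carrier R" if "r \<in> J" for r
    using that f_eq unfolding J_def by auto
  have f_add: "((r \<oplus>\<^bsub>R\<^esub> s) \<odot>\<^bsub>N\<^esub> n, f r \<oplus>\<^bsub>R\<^esub> f s) \<in> \<Gamma>" if "r \<in> J" "s \<in> J" for r s
    using add[OF f_in f_in, OF that] J_sub that n by (simp add: smult_l_distr)
  have f_smult: "((a \<otimes>\<^bsub>R\<^esub> r) \<odot>\<^bsub>N\<^esub> n, a \<otimes>\<^bsub>R\<^esub> f r) \<in> \<Gamma>" if "a \<in> carrier R" "r \<in> J" for a r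
    using smult[OF that(1) f_in[OF that(2)]] J_sub that n by (simp add: smult_assoc1)
  have "left_ideal R J"
    unfolding left_ideal_def
  proof (intro conjI ballI)
    show "J \<subseteq> carrier R" using J_sub by blast
    show "\<zero>\<^bsub>R\<^esub> \<in> J" unfolding J_def using zero n by auto
    show "x \<oplus>\<^bsub>R\<^esub> y \<in> J" if "x \<in> J" "y \<in> J" for x y
      using f_add[OF that] J_sub that unfolding J_def by blast
    show "a \<otimes>\<^bsub>R\<^esub> x \<in> J" if "a \<in> carrier R" "x \<in> J" for a x
      using f_smult[OF that] J_sub that unfolding J_def by blast
  qed
  then obtain w where w: "w \<in> carrier R" and fw: "\<And>r. r \<in> J \<Longrightarrow> f r = r \<otimes>\<^bsub>R\<^esub> w"
    using baerD[OF baer, of J f] f_in sub f_add f_smult f_eq by metis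
  define \<Gamma>' where "\<Gamma>' = {(x \<oplus>\<^bsub>N\<^esub> r \<odot>\<^bsub>N\<^esub> n, u \<oplus>\<^bsub>R\<^esub> r \<otimes>\<^bsub>R\<^esub> w) | x u r. (x, u) \<in> \<Gamma> \<and> r \<in> carrier R}"
  have mem: "(x \<oplus>\<^bsub>N\<^esub> r \<odot>\<^bsub>N\<^esub> n, u \<oplus>\<^bsub>R\<^esub> r \<otimes>\<^bsub>R\<^esub> w) \<in> \<Gamma>'"
    if "(x, u) \<in> \<Gamma>" "r \<in> carrier R" for x u r using that unfolding \<Gamma>'_def by blast
  have "partial_hom_graph R N \<Gamma>'"
    unfolding partial_hom_graph_def
  proof (intro conjI allI impI)
    show "\<Gamma>' \<subseteq> carrier N \<times> carrier R" unfolding \<Gamma>'_def using sub n w by auto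
  next
    fix p a q b assume "(p, a) \<in> \<Gamma>'" "(q, b) \<in> \<Gamma>'"
    then obtain x u r y v s where *: "(x, u) \<in> \<Gamma>" "r \<in> carrier R" "(y, v) \<in> \<Gamma>" "s \<in> carrier R"
      "p = x \<oplus>\<^bsub>N\<^esub> r \<odot>\<^bsub>N\<^esub> n" "a = u \<oplus>\<^bsub>R\<^esub> r \<otimes>\<^bsub>R\<^esub> w"
      "q = y \<oplus>\<^bsub>N\<^esub> s \<odot>\<^bsub>N\<^esub> n" "b = v \<oplus>\<^bsub>R\<^esub> s \<otimes>\<^bsub>R\<^esub> w"
      unfolding \<Gamma>'_def by blast
    have "p \<oplus>\<^bsub>N\<^esub> q = (x \<oplus>\<^bsub>N\<^esub> y) \<oplus>\<^bsub>N\<^esub> (r \<oplus>\<^bsub>R\<^esub> s) \<odot>\<^bsub>N\<^esub> n"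
      using * sub n by (simp add: smult_l_distr M.a_ac)
    moreover have "a \<oplus>\<^bsub>R\<^esub> b = (u \<oplus>\<^bsub>R\<^esub> v) \<oplus>\<^bsub>R\<^esub> (r \<oplus>\<^bsub>R\<^esub> s) \<otimes>\<^bsub>R\<^esub> w"
      using * sub w by (simp add: R.l_distr R.a_ac)
    ultimately show "(p \<oplus>\<^bsub>N\<^esub> q, a \<oplus>\<^bsub>R\<^esub> b) \<in> \<Gamma>'" using mem[OF add] * by simp
  next
    fix c p a assume c: "c \<in> carrier R" and "(p, a) \<in> \<Gamma>'"
    then obtain x u r where *: "(x, u) \<in> \<Gamma>" "r \<in> carrier R"
      "p = x \<oplus>\<^bsub>N\<^esub> r \<odot>\<^bsub>N\<^esub> n" "a = u \<oplus>\<^bsub>R\<^esub> r \<otimes>\<^bsub>R\<^esub> w"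
      unfolding \<Gamma>'_def by blast
    have "c \<odot>\<^bsub>N\<^esub> p = c \<odot>\<^bsub>N\<^esub> x \<oplus>\<^bsub>N\<^esub> (c \<otimes>\<^bsub>R\<^esub> r) \<odot>\<^bsub>N\<^esub> n"
      using * sub n c by (simp add: smult_r_distr smult_assoc1)
    moreover have "c \<otimes>\<^bsub>R\<^esub> a = c \<otimes>\<^bsub>R\<^esub> u \<oplus>\<^bsub>R\<^esub> (c \<otimes>\<^bsub>R\<^esub> r) \<otimes>\<^bsub>R\<^esub> w"
      using * sub w c by (simp add: R.r_distr R.m_assoc)
    ultimately show "(c \<odot>\<^bsub>N\<^esub> p, c \<otimes>\<^bsub>R\<^esub> a) \<in> \<Gamma>'" using mem[OF smult] * c by simp
  next
    fix a assume "(\<zero>\<^bsub>N\<^esub>, a) \<in> \<Gamma>'"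
    then obtain x u r where *: "(x, u) \<in> \<Gamma>" "r \<in> carrier R"
      "\<zero>\<^bsub>N\<^esub> = x \<oplus>\<^bsub>N\<^esub> r \<odot>\<^bsub>N\<^esub> n" "a = u \<oplus>\<^bsub>R\<^esub> r \<otimes>\<^bsub>R\<^esub> w"
      unfolding \<Gamma>'_def by blast
    have "r \<odot>\<^bsub>N\<^esub> n = \<ominus>\<^bsub>N\<^esub> x"
      using * sub n by (metis M.a_comm M.minus_equality smult_closed)
    moreover have "(\<ominus>\<^bsub>N\<^esub> x, \<ominus>\<^bsub>R\<^esub> u) \<in> \<Gamma>"
      using smult[of "\<ominus>\<^bsub>R\<^esub> \<one>\<^bsub>R\<^esub>" x u] * sub by (simp add: smult_minus_one R.l_minus)
    ultimately have rn: "(r \<odot>\<^bsub>N\<^esub> n, \<ominus>\<^bsub>R\<^esub> u) \<in> \<Gamma>" by simp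
    then have "r \<in> J" using * unfolding J_def by blast
    then have "r \<otimes>\<^bsub>R\<^esub> w = \<ominus>\<^bsub>R\<^esub> u" using fw f_eq[OF rn] by simp
    then show "a = \<zero>\<^bsub>R\<^esub>" using * sub by (simp add: R.r_neg)
  qed
  moreover have "\<Gamma> \<subseteq> \<Gamma>'"
  proof (rule subrelI)
    fix x u assume "(x, u) \<in> \<Gamma>"
    then show "(x, u) \<in> \<Gamma>'" using mem[of x u "\<zero>\<^bsub>R\<^esub>"] sub n w by simp
  qed
  moreover have "(n, w) \<in> \<Gamma>'" using mem[OF zero R.one_closed] n w by simp
  ultimately show ?thesis by blast
qed

lemma partial_hom_graph_Union:
  assumes "chain\<^sub>\<subseteq> \<C>" "\<And>\<Gamma>. \<Gamma> \<in> \<C> \<Longrightarrow> partial_hom_graph R N \<Gamma>"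
  shows "partial_hom_graph R N (\<Union>\<C>)"
  unfolding partial_hom_graph_def
proof (intro conjI allI impI)
  show "\<Union>\<C> \<subseteq> carrier N \<times> carrier R" using assms(2) unfolding partial_hom_graph_def by blast
  show "(x \<oplus>\<^bsub>N\<^esub> y, u \<oplus>\<^bsub>R\<^esub> v) \<in> \<Union>\<C>" if xy: "(x, u) \<in> \<Union>\<C>" "(y, v) \<in> \<Union>\<C>" for x u y v
  proof -
    obtain \<Gamma> where "\<Gamma> \<in> \<C>" "(x, u) \<in> \<Gamma>" "(y, v) \<in> \<Gamma>"
      using assms(1) xy unfolding chain_subset_def by blast
    then show ?thesis using assms(2) unfolding partial_hom_graph_def by blast
  qed
qed (use assms(2) in \<open>unfold partial_hom_graph_def, blast+\<close>)

text \<open>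
  By Zorn's lemma there is a maximal partial extension of \<open>f\<close> along \<open>i\<close>; by the extension by one
  element its domain is all of \<open>N\<close>. The universe \<open>'t\<close> is arbitrary here, so together with
  \<open>left_self_injective_imp_baer\<close> self-injectivity in one universe gives it in every universe.
\<close>

lemma baer_criterion:
  fixes R :: "('r, 'x) ring_scheme"
  assumes ring: "ring R" and baer: "baer R"
  shows "injective_left_module TYPE('t) R (regular_left_module R)"
  unfolding injective_left_module_def
proof (intro conjI allI impI ballI)
  show "left_module R (regular_left_module R)" by (rule ring.regular_left_module[OF ring])
  fix M N :: "('r, 't) module" and i f
  assume M: "left_module R M" and N: "left_module R N" and i: "i \<in> left_module_hom R M N"
    and inj: "inj_on i (carrier M)" and f: "f \<in> left_module_hom R M (regular_left_module R)"
  interpret M: left_module R M by (rule M)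
  interpret N: left_module R N by (rule N)
  have i_c: "i x \<in> carrier N" and i_add: "y \<in> carrier M \<Longrightarrow> i (x \<oplus>\<^bsub>M\<^esub> y) = i x \<oplus>\<^bsub>N\<^esub> i y"
    and i_smult: "a \<in> carrier R \<Longrightarrow> i (a \<odot>\<^bsub>M\<^esub> x) = a \<odot>\<^bsub>N\<^esub> i x" if "x \<in> carrier M" for x y a
    using i that unfolding left_module_hom_def by auto
  have f_c: "f x \<in> carrier R" and f_add: "y \<in> carrier M \<Longrightarrow> f (x \<oplus>\<^bsub>M\<^esub> y) = f x \<oplus>\<^bsub>R\<^esub> f y"
    and f_smult: "a \<in> carrier R \<Longrightarrow> f (a \<odot>\<^bsub>M\<^esub> x) = a \<otimes>\<^bsub>R\<^esub> f x" if "x \<in> carrier M" for x y a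
    using f that unfolding left_module_hom_def regular_left_module_def by auto
  have i0: "i \<zero>\<^bsub>M\<^esub> = \<zero>\<^bsub>N\<^esub>" and f0: "f \<zero>\<^bsub>M\<^esub> = \<zero>\<^bsub>R\<^esub>"
    using i_smult[of "\<zero>\<^bsub>M\<^esub>" "\<zero>\<^bsub>R\<^esub>"] i_c f_smult[of "\<zero>\<^bsub>M\<^esub>" "\<zero>\<^bsub>R\<^esub>"] f_c by simp_all
  define \<Gamma>0 where "\<Gamma>0 = {(i x, f x) | x. x \<in> carrier M}"
  have in0: "(i p, f p) \<in> \<Gamma>0" if "p \<in> carrier M" for p using that unfolding \<Gamma>0_def by blast
  have \<Gamma>0: "partial_hom_graph R N \<Gamma>0"
    unfolding partial_hom_graph_def
  proof (intro conjI allI impI)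
    show "\<Gamma>0 \<subseteq> carrier N \<times> carrier R" unfolding \<Gamma>0_def using i_c f_c by auto
    fix x u y v assume xu: "(x, u) \<in> \<Gamma>0" and yv: "(y, v) \<in> \<Gamma>0"
    show "(x \<oplus>\<^bsub>N\<^esub> y, u \<oplus>\<^bsub>R\<^esub> v) \<in> \<Gamma>0"
    proof -
      obtain p where p: "p \<in> carrier M" "x = i p" "u = f p"
        using xu unfolding \<Gamma>0_def by blast
      obtain q where q: "q \<in> carrier M" "y = i q" "v = f q"
        using yv unfolding \<Gamma>0_def by blast
      have "(i (p \<oplus>\<^bsub>M\<^esub> q), f (p \<oplus>\<^bsub>M\<^esub> q)) \<in> \<Gamma>0" using p q by (intro in0 M.M.a_closed)
      then show ?thesis using p q i_add f_add by metis
    qed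
  next
    fix a x u assume a: "a \<in> carrier R" and yv: "(x, u) \<in> \<Gamma>0"
    show "(a \<odot>\<^bsub>N\<^esub> x, a \<otimes>\<^bsub>R\<^esub> u) \<in> \<Gamma>0"
    proof -
      obtain p where p: "p \<in> carrier M" "x = i p" "u = f p"
        using yv unfolding \<Gamma>0_def by blast
      have "(i (a \<odot>\<^bsub>M\<^esub> p), f (a \<odot>\<^bsub>M\<^esub> p)) \<in> \<Gamma>0" using p a by (intro in0 M.smult_closed)
      then show ?thesis using p a i_smult f_smult by metis
    qed
  next
    fix u assume u: "(\<zero>\<^bsub>N\<^esub>, u) \<in> \<Gamma>0"
    show "u = \<zero>\<^bsub>R\<^esub>"
    proof -
      obtain x where x: "x \<in> carrier M" "i x = i \<zero>\<^bsub>M\<^esub>" "u = f x"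
        using u i0 unfolding \<Gamma>0_def by auto
      then have "x = \<zero>\<^bsub>M\<^esub>" using inj by (auto dest: inj_onD)
      then show ?thesis using x f0 by simp
    qed
  qed
  define \<A> where "\<A> = {\<Gamma>. partial_hom_graph R N \<Gamma> \<and> \<Gamma>0 \<subseteq> \<Gamma>}"
  have "\<exists>\<Gamma>\<in>\<A>. \<forall>\<Gamma>'\<in>\<A>. \<Gamma> \<subseteq> \<Gamma>' \<longrightarrow> \<Gamma>' = \<Gamma>"
  proof (rule subset_Zorn_nonempty)
    show "\<A> \<noteq> {}" using \<Gamma>0 unfolding \<A>_def by blast
    fix \<C> assume ne: "\<C> \<noteq> {}" and chain: "subset.chain \<A> \<C>"
    have "chain\<^sub>\<subseteq> \<C>" using chain unfolding subset_chain_def chain_subset_def by blast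
    moreover have "\<And>\<Gamma>. \<Gamma> \<in> \<C> \<Longrightarrow> \<Gamma> \<in> \<A>" using chain unfolding subset_chain_def by blast
    ultimately show "\<Union>\<C> \<in> \<A>"
      using partial_hom_graph_Union[of \<C> R N] ne unfolding \<A>_def by blast
  qed
  then obtain \<Gamma> where mem: "\<Gamma> \<in> \<A>" and maximal: "\<forall>\<Gamma>'\<in>\<A>. \<Gamma> \<subseteq> \<Gamma>' \<longrightarrow> \<Gamma>' = \<Gamma>" ..
  have \<Gamma>: "partial_hom_graph R N \<Gamma>" "\<Gamma>0 \<subseteq> \<Gamma>" using mem unfolding \<A>_def by auto
  have max: "\<Gamma>' = \<Gamma>" if "partial_hom_graph R N \<Gamma>'" "\<Gamma> \<subseteq> \<Gamma>'" for \<Gamma>'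
    using maximal that \<Gamma>(2) unfolding \<A>_def by simp
  have ne: "\<Gamma> \<noteq> {}" using \<Gamma>(2) M.M.zero_closed unfolding \<Gamma>0_def by blast
  have total: "\<exists>w. (n, w) \<in> \<Gamma>" if "n \<in> carrier N" for n
    using partial_hom_graph_extend[OF N baer \<Gamma>(1) ne that] max by metis
  note uniq = partial_hom_graph_single_valued[OF N \<Gamma>(1)]
  define g where "g n = (THE w. (n, w) \<in> \<Gamma>)" for n
  have g_eq: "g n = w" if "(n, w) \<in> \<Gamma>" for n w
    unfolding g_def using that uniq by blast
  have g_in: "(n, g n) \<in> \<Gamma>" if "n \<in> carrier N" for n
    using total[OF that] g_eq by auto
  have "g \<in> left_module_hom R N (regular_left_module R)"
    unfolding left_module_hom_def regular_left_module_def
  proof (intro CollectI conjI ballI)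
    show "g \<in> carrier N \<rightarrow> carrier \<lparr>carrier = carrier R, mult = (\<otimes>\<^bsub>R\<^esub>), one = \<one>\<^bsub>R\<^esub>, zero = \<zero>\<^bsub>R\<^esub>,
        add = (\<oplus>\<^bsub>R\<^esub>), smult = (\<otimes>\<^bsub>R\<^esub>)\<rparr>"
      using g_in \<Gamma>(1) unfolding partial_hom_graph_def by auto
  qed (use g_in g_eq \<Gamma>(1) in \<open>unfold partial_hom_graph_def, simp_all\<close>)
  moreover have "g (i x) = f x" if "x \<in> carrier M" for x
    using g_eq \<Gamma>(2) that unfolding \<Gamma>0_def by blast
  ultimately show "\<exists>g\<in>left_module_hom R N (regular_left_module R). \<forall>x\<in>carrier M. g (i x) = f x"
    by blast
qed

section \<open>The group ring and its action on formal sums\<close>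

locale group_ring_locale = A: ring A + G: group G
  for A :: "('a, 'x) ring_scheme" (structure) and G :: "('g, 'y) monoid_scheme"
begin

abbreviation AG :: "('g \<Rightarrow> 'a) ring"
  where "AG \<equiv> group_ring A G"

abbreviation conv :: "('g \<Rightarrow> 'a) \<Rightarrow> ('g \<Rightarrow> 'a) \<Rightarrow> 'g \<Rightarrow> 'a"  (infixl \<open>\<star>\<close> 70)
  where "f \<star> w \<equiv> f \<otimes>\<^bsub>AG\<^esub> w"

abbreviation pointwise_add :: "('g \<Rightarrow> 'a) \<Rightarrow> ('g \<Rightarrow> 'a) \<Rightarrow> 'g \<Rightarrow> 'a"  (infixl \<open>\<boxplus>\<close> 65)
  where "f \<boxplus> g \<equiv> f \<oplus>\<^bsub>AG\<^esub> g"

definition single :: "'g \<Rightarrow> 'a \<Rightarrow> 'g \<Rightarrow> 'a"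
  where "single y a = (\<lambda>x. if x = y then a else \<zero>)"

text \<open>
  Arbitrary functions on the group, that is, formal sums of group elements with no condition on the
  support. The convolution \<open>f \<star> w\<close> only sums over the support of \<open>f\<close>, so the group ring acts on these
  sums from the left. They supply what the group ring lacks when \<open>G\<close> is infinite: constant functions,
  which detect the augmentation, and multipliers of infinite support.
\<close>

definition formal :: "('g \<Rightarrow> 'a) set"
  where "formal = {w. (\<forall>x\<in>carrier G. w x \<in> carrier A) \<and> (\<forall>x. x \<notin> carrier G \<longrightarrow> w x = \<zero>)}"

lemma AG_carrier: "f \<in> carrier AG \<longleftrightarrow> f \<in> formal \<and> finite {x. f x \<noteq> \<zero>}"
  by (auto simp: group_ring_def formal_def)

lemma AG_carrier_formal: "f \<in> carrier AG \<Longrightarrow> f \<in> formal"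
  by (simp add: AG_carrier)

lemma plus_apply: "(f \<boxplus> g) x = f x \<oplus> g x"
  by (simp add: group_ring_def)

lemma AG_zero [simp]: "\<zero>\<^bsub>AG\<^esub> = (\<lambda>_. \<zero>)"
  by (simp add: group_ring_def)

lemma AG_one: "\<one>\<^bsub>AG\<^esub> = single \<one>\<^bsub>G\<^esub> \<one>"
  by (simp add: group_ring_def single_def)

lemma formal_outside: "w \<in> formal \<Longrightarrow> x \<notin> carrier G \<Longrightarrow> w x = \<zero>"
  by (simp add: formal_def)

lemma formalI:
  assumes "\<And>x. x \<in> carrier G \<Longrightarrow> w x \<in> carrier A" "\<And>x. x \<notin> carrier G \<Longrightarrow> w x = \<zero>"
  shows "w \<in> formal"
  using assms by (simp add: formal_def)

lemma formal_closed [simp]: "w \<in> formal \<Longrightarrow> w x \<in> carrier A"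
  by (cases "x \<in> carrier G") (auto simp: formal_def)

lemma plus_formal: "f \<in> formal \<Longrightarrow> g \<in> formal \<Longrightarrow> f \<boxplus> g \<in> formal"
  by (rule formalI) (auto simp: plus_apply formal_outside)

lemma plus_carrier: "f \<in> carrier AG \<Longrightarrow> g \<in> carrier AG \<Longrightarrow> f \<boxplus> g \<in> carrier AG"
proof -
  assume *: "f \<in> carrier AG" "g \<in> carrier AG"
  then have "{x. (f \<boxplus> g) x \<noteq> \<zero>} \<subseteq> {x. f x \<noteq> \<zero>} \<union> {x. g x \<noteq> \<zero>}" by (auto simp: plus_apply AG_carrier)
  moreover have "finite ({x. f x \<noteq> \<zero>} \<union> {x. g x \<noteq> \<zero>})" using * by (simp add: AG_carrier)
  ultimately show ?thesis using * by (simp add: AG_carrier plus_formal finite_subset)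
qed

lemma zero_carrier: "(\<lambda>_. \<zero>) \<in> carrier AG"
  by (simp add: AG_carrier formalI)

lemma zero_formal: "(\<lambda>_. \<zero>) \<in> formal"
  by (simp add: formalI)

lemma single_carrier: "y \<in> carrier G \<Longrightarrow> a \<in> carrier A \<Longrightarrow> single y a \<in> carrier AG"
proof -
  assume *: "y \<in> carrier G" "a \<in> carrier A"
  have "{x. single y a x \<noteq> \<zero>} \<subseteq> {y}" by (auto simp: single_def)
  then show ?thesis using * by (auto simp: AG_carrier single_def intro!: formalI intro: finite_subset)
qed

lemma single_formal: "y \<in> carrier G \<Longrightarrow> a \<in> carrier A \<Longrightarrow> single y a \<in> formal"
  by (simp add: single_carrier AG_carrier_formal)

text \<open>
  The group ring is additively generated by the elements \<open>single y a\<close>. This reduces every identity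
  below that is additive in an element of the group ring, associativity included, to the case of
  one group element, where convolution is a translation.
\<close>

lemma carrier_induct [consumes 1, case_names zero plus]:
  assumes f: "f \<in> carrier AG" and zero: "P (\<lambda>_. \<zero>)"
    and plus: "\<And>y a f. y \<in> carrier G \<Longrightarrow> a \<in> carrier A \<Longrightarrow> f \<in> carrier AG \<Longrightarrow> P f \<Longrightarrow> P (single y a \<boxplus> f)"
  shows "P f"
proof -
  have "P f" if "finite S" "f \<in> carrier AG" "{x. f x \<noteq> \<zero>} \<subseteq> S" for S f
    using that
  proof (induction S arbitrary: f rule: finite_induct)
    case empty
    then have "f = (\<lambda>_. \<zero>)" by auto
    then show ?case using zero by simp
  next
    case (insert y S)
    show ?case
    proof (cases "y \<in> carrier G")
      case True
      define f' where "f' = f(y := \<zero>)"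
      have f: "f \<in> formal" "finite {x. f x \<noteq> \<zero>}" using insert.prems by (auto simp: AG_carrier)
      have "{x. f' x \<noteq> \<zero>} \<subseteq> {x. f x \<noteq> \<zero>}" by (auto simp: f'_def)
      then have f': "f' \<in> carrier AG" using f formal_outside by (auto simp: AG_carrier f'_def intro!: formalI intro: finite_subset)
      moreover have "{x. f' x \<noteq> \<zero>} \<subseteq> S" using insert.prems(2) by (auto simp: f'_def)
      ultimately have "P f'" by (rule insert.IH)
      then have "P (single y (f y) \<boxplus> f')" using plus True f f' by simp
      moreover have "single y (f y) \<boxplus> f' = f" using f by (auto simp: plus_apply single_def f'_def)
      ultimately show ?thesis by simp
    next
      case False
      then have "f y = \<zero>" using insert.prems by (simp add: AG_carrier formal_outside)
      then have "{x. f x \<noteq> \<zero>} \<subseteq> S" using insert.prems(2) by auto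
      then show ?thesis using insert.IH insert.prems(1) by blast
    qed
  qed
  then show ?thesis using f by (auto simp: AG_carrier)
qed

text \<open>
  The support over which convolution sums varies with \<open>f\<close>; a common finite superset allows sums for
  different \<open>f\<close> to be compared.
\<close>

lemma conv_superset:
  assumes "finite S" "S \<subseteq> carrier G" "{y \<in> carrier G. f y \<noteq> \<zero>} \<subseteq> S"
    and "f \<in> formal" "w \<in> formal" "x \<in> carrier G"
  shows "(f \<star> w) x = (\<Oplus>y\<in>S. f y \<otimes> w (inv\<^bsub>G\<^esub> y \<otimes>\<^bsub>G\<^esub> x))"
proof -
  have "(f \<star> w) x = (\<Oplus>y\<in>{y \<in> carrier G. f y \<noteq> \<zero>}. f y \<otimes> w (inv\<^bsub>G\<^esub> y \<otimes>\<^bsub>G\<^esub> x))"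
    using assms(6) by (simp add: group_ring_def)
  also have "\<dots> = (\<Oplus>y\<in>S. f y \<otimes> w (inv\<^bsub>G\<^esub> y \<otimes>\<^bsub>G\<^esub> x))"
    by (rule A.add.finprod_mono_neutral_cong_left) (use assms in auto)
  finally show ?thesis .
qed

lemma conv_outside: "x \<notin> carrier G \<Longrightarrow> (f \<star> w) x = \<zero>"
  by (simp add: group_ring_def)

lemma conv_zero_left: "(\<lambda>_. \<zero>) \<star> w = (\<lambda>_. \<zero>)"
  by (auto simp: group_ring_def)

lemma conv_single:
  assumes "y \<in> carrier G" "a \<in> carrier A" "w \<in> formal"
  shows "single y a \<star> w = (\<lambda>x. if x \<in> carrier G then a \<otimes> w (inv\<^bsub>G\<^esub> y \<otimes>\<^bsub>G\<^esub> x) else \<zero>)"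
proof
  fix x
  show "(single y a \<star> w) x = (if x \<in> carrier G then a \<otimes> w (inv\<^bsub>G\<^esub> y \<otimes>\<^bsub>G\<^esub> x) else \<zero>)"
  proof (cases "x \<in> carrier G")
    case True
    have "(single y a \<star> w) x = (\<Oplus>z\<in>{y}. single y a z \<otimes> w (inv\<^bsub>G\<^esub> z \<otimes>\<^bsub>G\<^esub> x))"
      by (rule conv_superset) (use assms True single_formal in \<open>auto simp: single_def\<close>)
    then show ?thesis using assms True by (simp add: single_def)
  qed (simp add: conv_outside)
qed

lemma conv_plus_left:
  assumes "f \<in> carrier AG" "g \<in> carrier AG" "w \<in> formal"
  shows "(f \<boxplus> g) \<star> w = f \<star> w \<boxplus> g \<star> w"
proof
  fix x
  show "((f \<boxplus> g) \<star> w) x = (f \<star> w \<boxplus> g \<star> w) x"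
  proof (cases "x \<in> carrier G")
    case True
    define S where "S = {x. f x \<noteq> \<zero>} \<union> {x. g x \<noteq> \<zero>}"
    have fg: "f \<in> formal" "g \<in> formal" "finite S"
      using assms by (auto simp: AG_carrier S_def)
    have S: "S \<subseteq> carrier G" using fg formal_outside by (auto simp: S_def)
    have "((f \<boxplus> g) \<star> w) x = (\<Oplus>y\<in>S. (f \<boxplus> g) y \<otimes> w (inv\<^bsub>G\<^esub> y \<otimes>\<^bsub>G\<^esub> x))"
      by (rule conv_superset) (use fg S assms True plus_formal in \<open>auto simp: S_def plus_apply\<close>)
    also have "\<dots> = (\<Oplus>y\<in>S. f y \<otimes> w (inv\<^bsub>G\<^esub> y \<otimes>\<^bsub>G\<^esub> x) \<oplus> g y \<otimes> w (inv\<^bsub>G\<^esub> y \<otimes>\<^bsub>G\<^esub> x))"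
      by (rule A.finsum_cong') (use fg assms in \<open>auto simp: plus_apply A.l_distr\<close>)
    also have "\<dots> = (\<Oplus>y\<in>S. f y \<otimes> w (inv\<^bsub>G\<^esub> y \<otimes>\<^bsub>G\<^esub> x)) \<oplus> (\<Oplus>y\<in>S. g y \<otimes> w (inv\<^bsub>G\<^esub> y \<otimes>\<^bsub>G\<^esub> x))"
      by (rule A.finsum_addf) (use fg assms in auto)
    also have "(\<Oplus>y\<in>S. f y \<otimes> w (inv\<^bsub>G\<^esub> y \<otimes>\<^bsub>G\<^esub> x)) = (f \<star> w) x"
      by (rule conv_superset[symmetric]) (use fg S assms True in \<open>auto simp: S_def\<close>)
    also have "(\<Oplus>y\<in>S. g y \<otimes> w (inv\<^bsub>G\<^esub> y \<otimes>\<^bsub>G\<^esub> x)) = (g \<star> w) x"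
      by (rule conv_superset[symmetric]) (use fg S assms True in \<open>auto simp: S_def\<close>)
    finally show ?thesis by (subst plus_apply)
  qed (simp add: conv_outside plus_apply)
qed

lemma plus_zero_left: "w \<in> formal \<Longrightarrow> (\<lambda>_. \<zero>) \<boxplus> w = w"
  by (auto simp: plus_apply)

lemma plus_assoc: "u \<in> formal \<Longrightarrow> v \<in> formal \<Longrightarrow> w \<in> formal \<Longrightarrow> u \<boxplus> v \<boxplus> w = u \<boxplus> (v \<boxplus> w)"
  by (auto simp: plus_apply A.a_assoc)

lemma plus_commute: "u \<in> formal \<Longrightarrow> v \<in> formal \<Longrightarrow> u \<boxplus> v = v \<boxplus> u"
  by (auto simp: plus_apply A.a_comm)

lemma plus_plus_swap:
  assumes "u \<in> formal" "v \<in> formal" "u' \<in> formal" "v' \<in> formal"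
  shows "(u \<boxplus> v) \<boxplus> (u' \<boxplus> v') = (u \<boxplus> u') \<boxplus> (v \<boxplus> v')"
  using assms by (auto simp: plus_apply A.a_ac)

lemma conv_single_formal:
  assumes "y \<in> carrier G" "a \<in> carrier A" "w \<in> formal"
  shows "single y a \<star> w \<in> formal"
  unfolding conv_single[OF assms] using assms by (intro formalI) auto

lemma conv_formal:
  assumes "f \<in> carrier AG" "w \<in> formal" shows "f \<star> w \<in> formal"
  using assms
proof (induction f rule: carrier_induct)
  case zero
  then show ?case by (simp add: conv_zero_left formalI)
next
  case (plus y a f)
  then show ?case by (simp add: conv_plus_left single_carrier conv_single_formal plus_formal)
qed

lemma conv_plus_right:
  assumes "f \<in> carrier AG" "v \<in> formal" "w \<in> formal"
  shows "f \<star> (v \<boxplus> w) = f \<star> v \<boxplus> f \<star> w"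
  using assms
proof (induction f rule: carrier_induct)
  case zero
  then show ?case by (auto simp: conv_zero_left plus_apply)
next
  case (plus y a f)
  have "single y a \<star> (v \<boxplus> w) = single y a \<star> v \<boxplus> single y a \<star> w"
    using plus by (auto simp: conv_single plus_formal plus_apply A.r_distr)
  then show ?case
    using plus by (simp add: conv_plus_left single_carrier conv_formal plus_formal plus_plus_swap)
qed

lemma conv_single_single:
  assumes "y \<in> carrier G" "a \<in> carrier A" "z \<in> carrier G" "b \<in> carrier A"
  shows "single y a \<star> single z b = single (y \<otimes>\<^bsub>G\<^esub> z) (a \<otimes> b)"
proof -
  have "inv\<^bsub>G\<^esub> y \<otimes>\<^bsub>G\<^esub> x = z \<longleftrightarrow> x = y \<otimes>\<^bsub>G\<^esub> z" if "x \<in> carrier G" for x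
    using G.inv_solve_left' assms that by metis
  then show ?thesis
    using assms by (auto simp: conv_single single_formal) (auto simp: single_def fun_eq_iff)
qed

lemma conv_zero_right:
  assumes "f \<in> carrier AG" shows "f \<star> (\<lambda>_. \<zero>) = (\<lambda>_. \<zero>)"
proof -
  let ?z = "\<lambda>_. \<zero>"
  have "f \<star> ?z \<boxplus> f \<star> ?z = f \<star> ?z"
    using conv_plus_right[OF assms zero_formal zero_formal] plus_zero_left[OF zero_formal] by simp
  then have eq: "(f \<star> ?z) x \<oplus> (f \<star> ?z) x = (f \<star> ?z) x" for x
    using plus_apply[of "f \<star> ?z" "f \<star> ?z" x] by simp
  have "(f \<star> ?z) x = \<zero>" for x
    using eq[of x] conv_formal[OF assms zero_formal, THEN formal_closed, of x] by simp
  then show ?thesis by blast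
qed

lemma conv_closed:
  assumes "f \<in> carrier AG" "g \<in> carrier AG" shows "f \<star> g \<in> carrier AG"
  using assms(1)
proof (induction f rule: carrier_induct)
  case zero
  then show ?case by (simp add: conv_zero_left zero_carrier)
next
  case (plus y a f)
  have "single y a \<star> g \<in> carrier AG" using assms(2)
  proof (induction g rule: carrier_induct)
    case zero
    then show ?case using plus by (simp add: conv_zero_right single_carrier zero_carrier)
  next
    case (plus z b g)
    then show ?case using \<open>y \<in> carrier G\<close> \<open>a \<in> carrier A\<close>
      by (simp add: conv_plus_right single_carrier single_formal AG_carrier_formal
          conv_single_single plus_carrier)
  qed
  then show ?case
    using plus assms by (simp add: conv_plus_left single_carrier AG_carrier_formal plus_carrier)
qed

lemma conv_single_single_formal:
  assumes "y \<in> carrier G" "a \<in> carrier A" "z \<in> carrier G" "b \<in> carrier A" "w \<in> formal"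
  shows "(single y a \<star> single z b) \<star> w = single y a \<star> (single z b \<star> w)"
proof -
  have "single (y \<otimes>\<^bsub>G\<^esub> z) (a \<otimes> b) \<star> w = single y a \<star> (single z b \<star> w)"
    unfolding conv_single[OF assms(1,2) conv_single_formal[OF assms(3-5)]]
    using assms by (auto simp: conv_single A.m_assoc G.inv_mult_group G.m_assoc)
  then show ?thesis using assms by (simp add: conv_single_single)
qed

lemma conv_assoc:
  assumes "f \<in> carrier AG" "g \<in> carrier AG" "w \<in> formal"
  shows "(f \<star> g) \<star> w = f \<star> (g \<star> w)"
  using assms(1)
proof (induction f rule: carrier_induct)
  case zero
  then show ?case by (simp add: conv_zero_left)
next
  case (plus y a f)
  have "(single y a \<star> g) \<star> w = single y a \<star> (g \<star> w)" using assms(2)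
  proof (induction g rule: carrier_induct)
    case zero
    then show ?case using plus by (simp add: conv_zero_left conv_zero_right single_carrier)
  next
    case (plus z b g)
    then show ?case using \<open>y \<in> carrier G\<close> \<open>a \<in> carrier A\<close> \<open>w \<in> formal\<close>
      by (simp add: conv_plus_right conv_plus_left single_carrier AG_carrier_formal conv_closed
          conv_single_single_formal conv_formal)
  qed
  then show ?case
    using plus assms by (simp add: conv_plus_left single_carrier AG_carrier_formal conv_closed conv_formal)
qed

lemma conv_one_left: "w \<in> formal \<Longrightarrow> \<one>\<^bsub>AG\<^esub> \<star> w = w"
  by (auto simp: AG_one conv_single formal_outside)

lemma conv_one_right:
  assumes "f \<in> carrier AG" shows "f \<star> \<one>\<^bsub>AG\<^esub> = f"
  using assms
proof (induction f rule: carrier_induct)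
  case zero
  then show ?case by (simp add: conv_zero_left)
next
  case (plus y a f)
  then show ?case
    by (simp add: conv_plus_left single_carrier AG_one conv_single_single single_formal)
qed

lemma group_ring_is_ring: "ring AG"
proof (rule ringI)
  have neg: "\<exists>g\<in>carrier AG. g \<boxplus> f = \<zero>\<^bsub>AG\<^esub>" if f: "f \<in> carrier AG" for f
  proof
    have "{x. \<ominus> f x \<noteq> \<zero>} \<subseteq> {x. f x \<noteq> \<zero>}" by auto
    then show "(\<lambda>x. \<ominus> f x) \<in> carrier AG"
      using f by (auto simp: AG_carrier formal_outside intro!: formalI intro: finite_subset)
    show "(\<lambda>x. \<ominus> f x) \<boxplus> f = \<zero>\<^bsub>AG\<^esub>" using f by (auto simp: plus_apply AG_carrier A.l_neg)
  qed
  show "abelian_group AG"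
  proof (rule abelian_groupI)
    show "f \<boxplus> g = g \<boxplus> f" if "f \<in> carrier AG" "g \<in> carrier AG" for f g
      using that by (simp add: plus_commute AG_carrier_formal)
  qed (simp_all add: plus_carrier zero_carrier AG_carrier_formal plus_assoc plus_zero_left neg[simplified])
  show "monoid AG"
    by (rule monoidI)
      (simp_all add: conv_closed conv_assoc conv_one_left conv_one_right AG_carrier_formal
        AG_one[symmetric], simp add: AG_one single_carrier)
qed (simp_all add: conv_plus_left conv_plus_right AG_carrier_formal)

end

sublocale group_ring_locale \<subseteq> AG: ring "group_ring A G"
  by (rule group_ring_is_ring)

section \<open>Transfer of injectivity between coefficients and group ring\<close>

context group_ring_locale
begin

lemma single_plus: "a \<in> carrier A \<Longrightarrow> b \<in> carrier A \<Longrightarrow> single y (a \<oplus> b) = single y a \<boxplus> single y b"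
  by (auto simp: single_def plus_apply)

text \<open>
  The ring \<open>A\<close> embeds into the group ring by \<open>single \<one>\<^bsub>G\<^esub>\<close>.
\<close>

definition restrict_scalars :: "('g \<Rightarrow> 'a, 't) module \<Rightarrow> ('a, 't) module"
  where "restrict_scalars M = \<lparr>carrier = carrier M, mult = mult M, one = one M, zero = zero M,
    add = add M, smult = (\<lambda>a m. single \<one>\<^bsub>G\<^esub> a \<odot>\<^bsub>M\<^esub> m)\<rparr>"

lemma restrict_scalars_left_module:
  assumes "left_module AG M" shows "left_module A (restrict_scalars M)"
proof -
  interpret M: left_module AG M by (rule assms)
  have neg: "\<exists>y\<in>carrier M. y \<oplus>\<^bsub>M\<^esub> x = \<zero>\<^bsub>M\<^esub>" if "x \<in> carrier M" for x
    using M.M.l_neg[OF that] that by blast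
  have "abelian_group (restrict_scalars M)"
  proof (rule abelian_groupI)
    show "x \<oplus>\<^bsub>restrict_scalars M\<^esub> y = y \<oplus>\<^bsub>restrict_scalars M\<^esub> x"
      if "x \<in> carrier (restrict_scalars M)" "y \<in> carrier (restrict_scalars M)" for x y
      using that by (simp add: restrict_scalars_def M.M.a_comm)
  qed (simp_all add: restrict_scalars_def M.M.a_assoc neg)
  moreover have "single \<one>\<^bsub>G\<^esub> (a \<oplus> b) \<odot>\<^bsub>M\<^esub> x = single \<one>\<^bsub>G\<^esub> a \<odot>\<^bsub>M\<^esub> x \<oplus>\<^bsub>M\<^esub> single \<one>\<^bsub>G\<^esub> b \<odot>\<^bsub>M\<^esub> x"
    if "a \<in> carrier A" "b \<in> carrier A" "x \<in> carrier M" for a b x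
    using that by (simp add: single_plus single_carrier M.smult_l_distr)
  moreover have "single \<one>\<^bsub>G\<^esub> (a \<otimes> b) \<odot>\<^bsub>M\<^esub> x = single \<one>\<^bsub>G\<^esub> a \<odot>\<^bsub>M\<^esub> (single \<one>\<^bsub>G\<^esub> b \<odot>\<^bsub>M\<^esub> x)"
    if "a \<in> carrier A" "b \<in> carrier A" "x \<in> carrier M" for a b x
    using that conv_single_single[of "\<one>\<^bsub>G\<^esub>" a "\<one>\<^bsub>G\<^esub>" b]
    by (simp add: single_carrier M.smult_assoc1[symmetric])
  ultimately show ?thesis
    by (intro left_module.intro left_module_axioms.intro A.ring_axioms)
      (simp_all add: restrict_scalars_def single_carrier M.smult_r_distr flip: AG_one)
qed

text \<open>
  For finite \<open>G\<close> the group ring is coinduced from \<open>A\<close>: a homomorphism \<open>f\<close> into it is determined by the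
  \<open>A\<close>-linear map \<open>m \<mapsto> f m \<one>\<^bsub>G\<^esub>\<close>, because the coefficient of \<open>f m\<close> at \<open>x\<close> is the coefficient of
  \<open>f (x\<^bsup>-1\<^esup> m)\<close> at the identity. So one extends that \<open>A\<close>-linear map to \<open>\<psi>\<close> and recovers the
  homomorphism as \<open>n \<mapsto> (x \<mapsto> \<psi> (x\<^bsup>-1\<^esup> n))\<close>; finiteness makes its values finitely supported.
\<close>

lemma group_ring_injective:
  assumes baer: "baer A" and fin: "finite (carrier G)"
  shows "injective_left_module TYPE('t) AG (regular_left_module AG)"
  unfolding injective_left_module_def
proof (intro conjI allI impI ballI)
  show "left_module AG (regular_left_module AG)" by (rule AG.regular_left_module)
  fix M N :: "('g \<Rightarrow> 'a, 't) module" and i f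
  assume M: "left_module AG M" and N: "left_module AG N" and i: "i \<in> left_module_hom AG M N"
    and inj: "inj_on i (carrier M)" and f: "f \<in> left_module_hom AG M (regular_left_module AG)"
  interpret M: left_module AG M by (rule M)
  interpret N: left_module AG N by (rule N)
  have i_c: "i x \<in> carrier N" and i_add: "y \<in> carrier M \<Longrightarrow> i (x \<oplus>\<^bsub>M\<^esub> y) = i x \<oplus>\<^bsub>N\<^esub> i y"
    and i_smult: "b \<in> carrier AG \<Longrightarrow> i (b \<odot>\<^bsub>M\<^esub> x) = b \<odot>\<^bsub>N\<^esub> i x" if "x \<in> carrier M" for x y b
    using i that unfolding left_module_hom_def by auto
  have f_c: "f x \<in> carrier AG" and f_add: "y \<in> carrier M \<Longrightarrow> f (x \<oplus>\<^bsub>M\<^esub> y) = f x \<boxplus> f y"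
    and f_smult: "b \<in> carrier AG \<Longrightarrow> f (b \<odot>\<^bsub>M\<^esub> x) = b \<star> f x" if "x \<in> carrier M" for x y b
    using f that unfolding left_module_hom_def regular_left_module_def by auto
  have f_single: "f (single y a \<odot>\<^bsub>M\<^esub> x) z = a \<otimes> f x (inv\<^bsub>G\<^esub> y \<otimes>\<^bsub>G\<^esub> z)"
    if "y \<in> carrier G" "a \<in> carrier A" "x \<in> carrier M" "z \<in> carrier G" for x y a z
    using that by (simp add: f_smult single_carrier conv_single f_c AG_carrier_formal)
  have "i \<in> left_module_hom A (restrict_scalars M) (restrict_scalars N)"
    using i_c i_add i_smult by (auto simp: left_module_hom_def restrict_scalars_def single_carrier)
  moreover have "(\<lambda>m. f m \<one>\<^bsub>G\<^esub>) \<in> left_module_hom A (restrict_scalars M) (regular_left_module A)"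
    using f_c f_add f_single
    by (auto simp: left_module_hom_def restrict_scalars_def regular_left_module_def plus_apply
        AG_carrier_formal)
  moreover have "inj_on i (carrier (restrict_scalars M))"
    using inj by (simp add: restrict_scalars_def)
  ultimately have "\<exists>\<psi>\<in>left_module_hom A (restrict_scalars N) (regular_left_module A).
      \<forall>m\<in>carrier (restrict_scalars M). \<psi> (i m) = f m \<one>\<^bsub>G\<^esub>"
    by (intro injective_left_moduleD[OF baer_criterion[OF A.ring_axioms baer]
          restrict_scalars_left_module[OF M] restrict_scalars_left_module[OF N]])
  then obtain \<psi> where \<psi>: "\<psi> \<in> left_module_hom A (restrict_scalars N) (regular_left_module A)"
    and \<psi>_ext: "\<And>m. m \<in> carrier (restrict_scalars M) \<Longrightarrow> \<psi> (i m) = f m \<one>\<^bsub>G\<^esub>"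
    by blast
  have \<psi>_c: "\<psi> n \<in> carrier A" and \<psi>_add: "n' \<in> carrier N \<Longrightarrow> \<psi> (n \<oplus>\<^bsub>N\<^esub> n') = \<psi> n \<oplus> \<psi> n'"
    and \<psi>_smult: "a \<in> carrier A \<Longrightarrow> \<psi> (single \<one>\<^bsub>G\<^esub> a \<odot>\<^bsub>N\<^esub> n) = a \<otimes> \<psi> n"
    if "n \<in> carrier N" for n n' a
    using \<psi> that unfolding left_module_hom_def regular_left_module_def restrict_scalars_def by auto
  define g where "g n = (\<lambda>x. if x \<in> carrier G then \<psi> (single (inv\<^bsub>G\<^esub> x) \<one> \<odot>\<^bsub>N\<^esub> n) else \<zero>)" for n
  have g_formal: "g n \<in> formal" if "n \<in> carrier N" for n
    using that by (intro formalI) (auto simp: g_def \<psi>_c single_carrier)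
  have g_c: "g n \<in> carrier AG" if "n \<in> carrier N" for n
  proof -
    have "{x. g n x \<noteq> \<zero>} \<subseteq> carrier G" by (auto simp: g_def)
    then show ?thesis using fin finite_subset g_formal[OF that] by (auto simp: AG_carrier)
  qed
  have g_add: "g (n \<oplus>\<^bsub>N\<^esub> n') = g n \<boxplus> g n'" if "n \<in> carrier N" "n' \<in> carrier N" for n n'
    using that by (auto simp: g_def plus_apply \<psi>_add single_carrier N.smult_r_distr)
  have g_single: "g (single y a \<odot>\<^bsub>N\<^esub> n) = single y a \<star> g n"
    if y: "y \<in> carrier G" and a: "a \<in> carrier A" and n: "n \<in> carrier N" for y a n
  proof
    fix x
    show "g (single y a \<odot>\<^bsub>N\<^esub> n) x = (single y a \<star> g n) x"
    proof (cases "x \<in> carrier G")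
      case x: True
      have "single (inv\<^bsub>G\<^esub> x) \<one> \<odot>\<^bsub>N\<^esub> (single y a \<odot>\<^bsub>N\<^esub> n) = single (inv\<^bsub>G\<^esub> x \<otimes>\<^bsub>G\<^esub> y) a \<odot>\<^bsub>N\<^esub> n"
        using x y a n by (simp add: N.smult_assoc1[symmetric] single_carrier conv_single_single)
      also have "\<dots> = single \<one>\<^bsub>G\<^esub> a \<odot>\<^bsub>N\<^esub> (single (inv\<^bsub>G\<^esub> (inv\<^bsub>G\<^esub> y \<otimes>\<^bsub>G\<^esub> x)) \<one> \<odot>\<^bsub>N\<^esub> n)"
        using x y a n
        by (simp add: N.smult_assoc1[symmetric] single_carrier conv_single_single G.inv_mult_group)
      finally show ?thesis
        using x y a n by (simp add: g_def conv_single g_formal[unfolded g_def] \<psi>_smult single_carrier)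
    qed (simp add: g_def conv_outside)
  qed
  have g_smult: "g (b \<odot>\<^bsub>N\<^esub> n) = b \<star> g n" if b: "b \<in> carrier AG" and n: "n \<in> carrier N" for b n
    using b
  proof (induction b rule: carrier_induct)
    case zero
    have "g \<zero>\<^bsub>N\<^esub> = (\<lambda>_. \<zero>)"
    proof -
      have "\<psi> \<zero>\<^bsub>N\<^esub> = \<zero>"
        using \<psi>_add[of "\<zero>\<^bsub>N\<^esub>" "\<zero>\<^bsub>N\<^esub>"] \<psi>_c[of "\<zero>\<^bsub>N\<^esub>"] by simp
      moreover have "b \<odot>\<^bsub>N\<^esub> \<zero>\<^bsub>N\<^esub> = \<zero>\<^bsub>N\<^esub>" if "b \<in> carrier AG" for b
        using that N.smult_r_distr[of b "\<zero>\<^bsub>N\<^esub>" "\<zero>\<^bsub>N\<^esub>"] N.smult_closed[of b "\<zero>\<^bsub>N\<^esub>"] by simp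
      ultimately show ?thesis by (auto simp: g_def single_carrier)
    qed
    then show ?case using N.smult_l_null[OF n] by (simp add: conv_zero_left)
  next
    case (plus y a b)
    then show ?case using n
      by (simp add: N.smult_l_distr single_carrier g_add g_single conv_plus_left g_formal)
  qed
  have "g \<in> left_module_hom AG N (regular_left_module AG)"
    using g_c g_add g_smult by (auto simp: left_module_hom_def regular_left_module_def)
  moreover have "g (i m) = f m" if m: "m \<in> carrier M" for m
  proof
    fix x
    show "g (i m) x = f m x"
    proof (cases "x \<in> carrier G")
      case x: True
      have "\<psi> (i (single (inv\<^bsub>G\<^esub> x) \<one> \<odot>\<^bsub>M\<^esub> m)) = f (single (inv\<^bsub>G\<^esub> x) \<one> \<odot>\<^bsub>M\<^esub> m) \<one>\<^bsub>G\<^esub>"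
        using \<psi>_ext m x by (auto simp: restrict_scalars_def single_carrier)
      then show ?thesis
        using x m by (simp add: g_def i_smult f_single single_carrier f_c AG_carrier_formal)
    next
      case False
      then show ?thesis using f_c[OF m] by (simp add: g_def AG_carrier formal_outside)
    qed
  qed
  ultimately show "\<exists>g\<in>left_module_hom AG N (regular_left_module AG). \<forall>x\<in>carrier M. g (i x) = f x"
    by blast
qed

text \<open>
  A homomorphism \<open>f : J \<rightarrow> A\<close>, applied to each coefficient, is a homomorphism from the left ideal
  \<open>J[G]\<close> to the group ring. If that is right multiplication by \<open>w\<close>, then \<open>f\<close> is right multiplication by
  the coefficient of \<open>w\<close> at the identity.
\<close>

lemma baer_coefficients:
  assumes baer: "baer AG" shows "baer A"
  unfolding baer_def
proof (intro allI impI)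
  fix J f
  assume J: "left_ideal A J" and f: "f \<in> J \<rightarrow> carrier A"
    and add: "\<forall>x\<in>J. \<forall>y\<in>J. f (x \<oplus> y) = f x \<oplus> f y"
    and lin: "\<forall>a\<in>carrier A. \<forall>x\<in>J. f (a \<otimes> x) = a \<otimes> f x"
  have J_sub: "x \<in> carrier A" and f_c: "f x \<in> carrier A" if "x \<in> J" for x
    using J f that unfolding left_ideal_def by auto
  have J0: "\<zero> \<in> J" and J_add: "\<And>x y. x \<in> J \<Longrightarrow> y \<in> J \<Longrightarrow> x \<oplus> y \<in> J"
    and J_mult: "\<And>a x. a \<in> carrier A \<Longrightarrow> x \<in> J \<Longrightarrow> a \<otimes> x \<in> J"
    using J unfolding left_ideal_def by auto
  have f0: "f \<zero> = \<zero>" using lin[rule_format, of \<zero> \<zero>] f_c[OF J0] J0 by simp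
  define K where "K = {x \<in> carrier AG. \<forall>z. x z \<in> J}"
  define F where "F x = (\<lambda>z. f (x z))" for x :: "'g \<Rightarrow> 'a"
  have K_sub: "x \<in> carrier AG" and K_J: "x z \<in> J" if "x \<in> K" for x z
    using that unfolding K_def by auto
  have F_c: "F x \<in> carrier AG" if x: "x \<in> K" for x
  proof -
    have "{z. F x z \<noteq> \<zero>} \<subseteq> {z. x z \<noteq> \<zero>}" by (auto simp: F_def f0)
    then show ?thesis
      using K_sub[OF x] K_J[OF x] f_c f0
      by (auto simp: AG_carrier F_def formal_outside intro!: formalI intro: finite_subset)
  qed
  have K_plus: "x \<boxplus> y \<in> K" and F_plus: "F (x \<boxplus> y) = F x \<boxplus> F y" if "x \<in> K" "y \<in> K" for x y
    using that add by (auto simp: K_def F_def plus_apply plus_carrier J_add)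
  have *: "b \<star> x \<in> K \<and> F (b \<star> x) = b \<star> F x" if b: "b \<in> carrier AG" and x: "x \<in> K" for b x
    using b
  proof (induction b rule: carrier_induct)
    case zero
    then show ?case by (simp add: conv_zero_left K_def F_def zero_carrier J0 f0)
  next
    case (plus y a b)
    have "single y a \<star> x \<in> K"
      using plus x K_J[OF x] J0
      by (auto simp: K_def conv_closed single_carrier) (auto simp: conv_single AG_carrier_formal J_mult)
    moreover have "F (single y a \<star> x) = single y a \<star> F x"
      using plus x K_J[OF x] K_sub[OF x] F_c[OF x] lin
      by (auto simp: conv_single AG_carrier_formal F_def f0)
    ultimately show ?case
      using plus x K_plus F_plus
      by (simp add: conv_plus_left single_carrier AG_carrier_formal K_sub F_c)
  qed
  have "left_ideal AG K"
    unfolding left_ideal_def using K_plus * by (auto simp: K_def zero_carrier J0)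
  then obtain w where w: "w \<in> carrier AG" and Fw: "\<And>x. x \<in> K \<Longrightarrow> F x = x \<star> w"
    using baerD[OF baer, of K F] F_c F_plus * by metis
  have "f r = r \<otimes> w \<one>\<^bsub>G\<^esub>" if r: "r \<in> J" for r
  proof -
    have "single \<one>\<^bsub>G\<^esub> r \<in> K"
      using r J0 J_sub single_carrier by (auto simp: K_def) (auto simp: single_def)
    then have "F (single \<one>\<^bsub>G\<^esub> r) \<one>\<^bsub>G\<^esub> = (single \<one>\<^bsub>G\<^esub> r \<star> w) \<one>\<^bsub>G\<^esub>" using Fw by simp
    then show ?thesis
      using r w J_sub by (simp add: conv_single AG_carrier_formal) (simp add: F_def single_def)
  qed
  moreover have "w \<one>\<^bsub>G\<^esub> \<in> carrier A" using w by (simp add: AG_carrier_formal)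
  ultimately show "\<exists>w\<in>carrier A. \<forall>x\<in>J. f x = x \<otimes> w" by blast
qed

end

section \<open>Finiteness of the group\<close>

text \<open>
  Baer's condition makes finitely generated right ideals right annihilators, by induction on the
  generators. For one more generator \<open>x\<close>, let \<open>N\<close> be the left annihilator of the others.
  If every element of \<open>N\<close> that kills \<open>x\<close> kills \<open>y\<close>, then \<open>a x \<mapsto> a y\<close> is well defined on the left ideal \<open>N x\<close>, hence
  right multiplication by some \<open>w\<close>, so that \<open>y - x w\<close> is killed by \<open>N\<close> and induction applies to it.
  Allowing an arbitrary right ideal \<open>K\<close> around the generators avoids speaking of generated ideals.
\<close>

lemma (in ring) double_annihilator_subset:
  assumes baer: "baer R" and "finite S" "S \<subseteq> K" and K: "K \<subseteq> carrier R" "\<zero> \<in> K"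
    and K_add: "\<And>x y. x \<in> K \<Longrightarrow> y \<in> K \<Longrightarrow> x \<oplus> y \<in> K"
    and K_mult: "\<And>x b. x \<in> K \<Longrightarrow> b \<in> carrier R \<Longrightarrow> x \<otimes> b \<in> K"
    and y: "y \<in> carrier R"
    and ann: "\<And>a. a \<in> carrier R \<Longrightarrow> \<forall>s\<in>S. a \<otimes> s = \<zero> \<Longrightarrow> a \<otimes> y = \<zero>"
  shows "y \<in> K"
  using \<open>finite S\<close> \<open>S \<subseteq> K\<close> y ann
proof (induction S arbitrary: y rule: finite_induct)
  case empty
  have "\<one> \<otimes> y = \<zero>" using empty by blast
  then have "y = \<zero>" using l_one[OF empty.prems(2)] by metis
  then show ?case using K by simp
next
  case (insert x S)
  define N where "N = {a \<in> carrier R. \<forall>s\<in>S. a \<otimes> s = \<zero>}"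
  have x: "x \<in> carrier R" and S: "S \<subseteq> carrier R" using insert.prems K by auto
  have N_c: "a \<in> carrier R" if "a \<in> N" for a using that by (simp add: N_def)
  have N_add: "a \<oplus> b \<in> N" if "a \<in> N" "b \<in> N" for a b
    using that S by (auto simp: N_def l_distr subset_iff)
  have N_mult: "c \<otimes> a \<in> N" if "c \<in> carrier R" "a \<in> N" for a c
    using that S by (auto simp: N_def m_assoc subset_iff)
  have N_zero: "\<zero> \<in> N" using S by (auto simp: N_def subset_iff)
  define f where "f z = (SOME a. a \<in> N \<and> z = a \<otimes> x) \<otimes> y" for z
  have f_eq: "f (a \<otimes> x) = a \<otimes> y" if a: "a \<in> N" for a
  proof -
    define b where "b = (SOME b. b \<in> N \<and> a \<otimes> x = b \<otimes> x)"
    have b: "b \<in> N" "a \<otimes> x = b \<otimes> x"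
      using someI[of "\<lambda>b. b \<in> N \<and> a \<otimes> x = b \<otimes> x" a] a unfolding b_def by auto
    have nb: "\<ominus> b = (\<ominus> \<one>) \<otimes> b" using N_c b by (simp add: l_minus)
    \<comment> \<open>Two representations of \<open>a \<otimes> x\<close> differ by an element that kills all generators.\<close>
    have "a \<oplus> \<ominus> b \<in> N" unfolding nb using a b N_add N_mult by simp
    moreover have "(a \<oplus> \<ominus> b) \<otimes> x = \<zero>"
      using a b x N_c by (simp add: l_distr l_minus r_neg)
    ultimately have "(a \<oplus> \<ominus> b) \<otimes> y = \<zero>"
      using insert.prems(3)[of "a \<oplus> \<ominus> b"] by (simp add: N_def)
    then have "a \<otimes> y \<oplus> \<ominus> (b \<otimes> y) = \<zero>"
      using a b N_c insert.prems(2) by (simp add: l_distr l_minus)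
    then have "a \<otimes> y = b \<otimes> y"
      using eq_if_minus_eq_zero[of "a \<otimes> y" "b \<otimes> y"] a b N_c insert.prems(2)
      unfolding a_minus_def by blast
    then show ?thesis by (simp add: f_def b_def)
  qed
  define L where "L = (\<lambda>a. a \<otimes> x) ` N"
  have L_add: "a \<otimes> x \<oplus> b \<otimes> x = (a \<oplus> b) \<otimes> x" if "a \<in> N" "b \<in> N" for a b
    using that N_c x by (simp add: l_distr)
  have L_mult: "c \<otimes> (a \<otimes> x) = (c \<otimes> a) \<otimes> x" if "a \<in> N" "c \<in> carrier R" for a c
    using that N_c x by (simp add: m_assoc)
  have "left_ideal R L"
    unfolding left_ideal_def
  proof (intro conjI ballI)
    show "L \<subseteq> carrier R" using N_c x by (auto simp: L_def)
    show "\<zero> \<in> L" using N_zero x by (auto simp: L_def intro: image_eqI[of _ _ \<zero>])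
    show "u \<oplus> v \<in> L" if "u \<in> L" "v \<in> L" for u v
      using that L_add N_add by (auto simp: L_def)
    show "c \<otimes> u \<in> L" if "c \<in> carrier R" "u \<in> L" for c u
      using that L_mult N_mult by (auto simp: L_def)
  qed
  moreover have "f u \<in> carrier R" if "u \<in> L" for u
    using that f_eq N_c insert.prems(2) by (auto simp: L_def)
  moreover have "f (u \<oplus> v) = f u \<oplus> f v" if "u \<in> L" "v \<in> L" for u v
    using that f_eq N_c N_add insert.prems(2) by (auto simp: L_def L_add l_distr)
  moreover have "f (c \<otimes> u) = c \<otimes> f u" if "c \<in> carrier R" "u \<in> L" for c u
    using that f_eq N_c N_mult insert.prems(2) by (auto simp: L_def L_mult m_assoc)
  ultimately obtain w where w: "w \<in> carrier R" and fw: "\<And>u. u \<in> L \<Longrightarrow> f u = u \<otimes> w"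
    using baerD[OF baer, of L f] by metis
  have "y \<oplus> \<ominus> (x \<otimes> w) \<in> K"
  proof (rule insert.IH)
    show "S \<subseteq> K" "y \<oplus> \<ominus> (x \<otimes> w) \<in> carrier R" using insert.prems x w by auto
    fix a assume a: "a \<in> carrier R" "\<forall>s\<in>S. a \<otimes> s = \<zero>"
    then have "a \<in> N" by (simp add: N_def)
    then have "a \<otimes> y = a \<otimes> x \<otimes> w" using fw[of "a \<otimes> x"] f_eq by (simp add: L_def)
    then show "a \<otimes> (y \<oplus> \<ominus> (x \<otimes> w)) = \<zero>"
      using a x w insert.prems(2) by (simp add: r_distr r_minus m_assoc r_neg)
  qed
  moreover have "x \<otimes> w \<in> K" using insert.prems(1) w K_mult by simp
  ultimately have "y \<oplus> \<ominus> (x \<otimes> w) \<oplus> x \<otimes> w \<in> K" by (rule K_add)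
  then show ?case using x w insert.prems(2) by (simp add: a_assoc l_neg)
qed

lemma (in group) locally_finite_chain:
  assumes inf: "infinite (carrier G)"
    and lf: "\<And>T. finite T \<Longrightarrow> T \<subseteq> carrier G \<Longrightarrow> finite (generate G T)"
  obtains H :: "nat \<Rightarrow> 'a set"
    where "\<And>n. subgroup (H n) G" "\<And>n. finite (H n)" "\<And>n. H n \<subset> H (Suc n)"
proof -
  have "\<exists>H. \<forall>n. (subgroup (H n) G \<and> finite (H n)) \<and> H n \<subset> H (Suc n)"
  proof (rule dependent_nat_choice)
    show "\<exists>H. subgroup H G \<and> finite H" using triv_subgroup by blast
    fix H and n :: nat assume H: "subgroup H G \<and> finite H"
    then obtain g where g: "g \<in> carrier G" "g \<notin> H"
      using inf by (metis finite_subset subsetI)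
    have sub: "insert g H \<subseteq> carrier G" using g H subgroup.subset by blast
    have "subgroup (generate G (insert g H)) G" using sub by (rule generate_is_subgroup)
    moreover have "finite (generate G (insert g H))" using lf sub H by simp
    moreover have "H \<subset> generate G (insert g H)"
      using g by (auto intro: generate.incl)
    ultimately show "\<exists>H'. (subgroup H' G \<and> finite H') \<and> H \<subset> H'" by blast
  qed
  then show thesis using that by blast
qed

context group_ring_locale
begin

lemma conv_single_right:
  assumes "f \<in> carrier AG" "h \<in> carrier G" "b \<in> carrier A" "x \<in> carrier G"
  shows "(f \<star> single h b) x = f (x \<otimes>\<^bsub>G\<^esub> inv\<^bsub>G\<^esub> h) \<otimes> b"
  using assms(1)
proof (induction f rule: carrier_induct)
  case zero
  then show ?case using assms by (simp add: conv_zero_left)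
next
  case (plus y a f)
  have "x \<otimes>\<^bsub>G\<^esub> inv\<^bsub>G\<^esub> h = y \<longleftrightarrow> x = y \<otimes>\<^bsub>G\<^esub> h"
    using G.inv_solve_right'[of y x h] plus assms by auto
  then have 1: "(single y a \<star> single h b) x = single y a (x \<otimes>\<^bsub>G\<^esub> inv\<^bsub>G\<^esub> h) \<otimes> b"
    using plus assms unfolding conv_single_single[OF plus(1,2) assms(2,3)]
    by (simp add: single_def)
  have 2: "(single y a \<boxplus> f) \<star> single h b = single y a \<star> single h b \<boxplus> f \<star> single h b"
    using plus assms by (simp add: conv_plus_left single_carrier single_formal)
  show ?case
    unfolding 2 unfolding plus_apply 1
    using plus assms by (simp add: single_formal A.l_distr AG_carrier_formal)
qed

definition one_minus :: "'g \<Rightarrow> 'g \<Rightarrow> 'a"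
  where "one_minus h = single \<one>\<^bsub>G\<^esub> \<one> \<boxplus> single h (\<ominus> \<one>)"

lemma one_minus_carrier: "h \<in> carrier G \<Longrightarrow> one_minus h \<in> carrier AG"
  by (simp add: one_minus_def plus_carrier single_carrier)

lemma one_minus_conv:
  assumes "h \<in> carrier G" "w \<in> formal" "x \<in> carrier G"
  shows "(one_minus h \<star> w) x = w x \<ominus> w (inv\<^bsub>G\<^esub> h \<otimes>\<^bsub>G\<^esub> x)"
proof -
  have "one_minus h \<star> w = single \<one>\<^bsub>G\<^esub> \<one> \<star> w \<boxplus> single h (\<ominus> \<one>) \<star> w"
    using assms by (simp add: one_minus_def conv_plus_left single_carrier)
  then show ?thesis
    using assms by (simp add: plus_apply conv_single A.l_minus a_minus_def)
qed

lemma conv_one_minus: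
  assumes "h \<in> carrier G" "f \<in> carrier AG" "x \<in> carrier G"
  shows "(f \<star> one_minus h) x = f x \<ominus> f (x \<otimes>\<^bsub>G\<^esub> inv\<^bsub>G\<^esub> h)"
proof -
  have "f \<star> one_minus h = f \<star> single \<one>\<^bsub>G\<^esub> \<one> \<boxplus> f \<star> single h (\<ominus> \<one>)"
    using assms by (simp add: one_minus_def conv_plus_right single_formal)
  then show ?thesis
    using assms by (simp add: plus_apply conv_single_right A.r_minus a_minus_def AG_carrier_formal)
qed

definition const :: "'a \<Rightarrow> 'g \<Rightarrow> 'a"
  where "const c = (\<lambda>x. if x \<in> carrier G then c else \<zero>)"

lemma const_formal: "c \<in> carrier A \<Longrightarrow> const c \<in> formal"
  by (rule formalI) (auto simp: const_def)

lemma conv_const: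
  assumes "b \<in> carrier AG" "c \<in> carrier A"
  shows "\<exists>c'\<in>carrier A. b \<star> const c = const c'"
  using assms(1)
proof (induction b rule: carrier_induct)
  case zero
  have "b \<star> const c = const \<zero>" if "b = (\<lambda>_. \<zero>)" for b
    using that by (auto simp: conv_zero_left const_def)
  then show ?case by blast
next
  case (plus y a b)
  then obtain d where d: "d \<in> carrier A" "b \<star> const c = const d" by blast
  have "single y a \<star> const c = const (a \<otimes> c)"
    using plus assms by (auto simp: conv_single const_formal) (auto simp: const_def)
  moreover have "const (a \<otimes> c) \<boxplus> const d = const (a \<otimes> c \<oplus> d)"
    by (auto simp: plus_apply const_def)
  ultimately show ?case
    using plus assms d by (auto simp: conv_plus_left single_carrier const_formal)
qed

text \<open>
  If the subgroup generated by a finite set \<open>T\<close> is infinite, then no nonzero \<open>f\<close> of finite support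
  satisfies \<open>f \<star> (1 - h) = 0\<close> for all \<open>h\<close> in \<open>T\<close>: such an \<open>f\<close> is constant on the left cosets of that
  subgroup. So the left annihilator of the \<open>1 - h\<close> is zero, and the double annihilator property puts
  \<open>1\<close> into every right ideal that contains them, in particular into the augmentation ideal.
\<close>

lemma baer_imp_locally_finite:
  assumes baer: "baer AG" and one: "\<one> \<noteq> \<zero>" and T: "finite T" "T \<subseteq> carrier G"
  shows "finite (generate G T)"
proof (rule ccontr)
  assume inf: "infinite (generate G T)"
  \<comment> \<open>The augmentation ideal: \<open>x \<star> const c\<close> is the constant function whose value is the sum of
      the coefficients of \<open>x\<close>, times \<open>c\<close>.\<close>
  define K where "K = {x \<in> carrier AG. \<forall>c\<in>carrier A. x \<star> const c = (\<lambda>_. \<zero>)}"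
  have "\<one>\<^bsub>AG\<^esub> \<in> K"
  proof (rule AG.double_annihilator_subset[OF baer])
    show "finite (one_minus ` T)" using T by simp
    show "one_minus ` T \<subseteq> K"
    proof
      fix d assume "d \<in> one_minus ` T"
      then obtain h where h: "h \<in> carrier G" "d = one_minus h" using T by auto
      have "(one_minus h \<star> const c) x = \<zero>" if "c \<in> carrier A" for c x
        using one_minus_conv[OF h(1) const_formal[OF that], of x] h that conv_outside
        by (cases "x \<in> carrier G") (auto simp: const_def a_minus_def A.r_neg)
      then show "d \<in> K" using h by (auto simp: K_def one_minus_carrier)
    qed
    show "K \<subseteq> carrier AG" by (auto simp: K_def)
    show "\<zero>\<^bsub>AG\<^esub> \<in> K" by (simp add: K_def zero_carrier conv_zero_left)
    show "x \<boxplus> y \<in> K" if "x \<in> K" "y \<in> K" for x y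
      using that by (simp add: K_def plus_carrier conv_plus_left const_formal plus_zero_left zero_formal)
    show "x \<star> b \<in> K" if x: "x \<in> K" and b: "b \<in> carrier AG" for x b
    proof -
      have "x \<star> b \<star> const c = (\<lambda>_. \<zero>)" if c: "c \<in> carrier A" for c
        using conv_const[OF b c] x b c by (auto simp: K_def conv_assoc const_formal)
      then show ?thesis using x b by (simp add: K_def conv_closed)
    qed
    show "\<one>\<^bsub>AG\<^esub> \<in> carrier AG" by (rule AG.one_closed)
  next
    fix f assume f: "f \<in> carrier AG" and ann: "\<forall>s\<in>one_minus ` T. f \<star> s = \<zero>\<^bsub>AG\<^esub>"
    have fc: "f x \<in> carrier A" for x using f by (simp add: AG_carrier_formal)
    have inv_T: "f (x \<otimes>\<^bsub>G\<^esub> inv\<^bsub>G\<^esub> h) = f x" if "h \<in> T" "x \<in> carrier G" for h x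
    proof -
      have "f x \<ominus> f (x \<otimes>\<^bsub>G\<^esub> inv\<^bsub>G\<^esub> h) = \<zero>"
        using conv_one_minus[of h f x] ann f that T by auto
      then show ?thesis using fc A.eq_if_minus_eq_zero[of "f x" "f (x \<otimes>\<^bsub>G\<^esub> inv\<^bsub>G\<^esub> h)"] by simp
    qed
    have f_inv: "h \<in> carrier G \<and> (\<forall>x\<in>carrier G. f (x \<otimes>\<^bsub>G\<^esub> h) = f x)" if "h \<in> generate G T" for h
      using that
    proof (induction rule: generate.induct)
      case one
      then show ?case by simp
    next
      case (incl h)
      then have h: "h \<in> carrier G" using T by blast
      have "f (x \<otimes>\<^bsub>G\<^esub> h) = f x" if "x \<in> carrier G" for x
        using inv_T[OF incl, of "x \<otimes>\<^bsub>G\<^esub> h"] that h by (simp add: G.m_assoc)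
      then show ?case using h by blast
    next
      case (inv h)
      then show ?case using inv_T T by auto
    next
      case (eng h1 h2)
      then show ?case by (simp flip: G.m_assoc)
    qed
    have "f x = \<zero>" if x: "x \<in> carrier G" for x
    proof (rule ccontr)
      assume "f x \<noteq> \<zero>"
      then have "(\<lambda>h. x \<otimes>\<^bsub>G\<^esub> h) ` generate G T \<subseteq> {z. f z \<noteq> \<zero>}" using f_inv x by auto
      then have "finite ((\<lambda>h. x \<otimes>\<^bsub>G\<^esub> h) ` generate G T)"
        using f finite_subset by (auto simp: AG_carrier)
      moreover have "inj_on (\<lambda>h. x \<otimes>\<^bsub>G\<^esub> h) (generate G T)"
        using f_inv x by (auto intro!: inj_onI)
      ultimately show False using inf finite_imageD by blast
    qed
    then have "f = (\<lambda>_. \<zero>)" using f formal_outside AG_carrier_formal by blast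
    then show "f \<star> \<one>\<^bsub>AG\<^esub> = \<zero>\<^bsub>AG\<^esub>" by (simp add: conv_zero_left)
  qed
  then have "const \<one> = (\<lambda>_. \<zero>)" using conv_one_left[OF const_formal[of \<one>]] by (simp add: K_def)
  then show False using one by (metis G.one_closed const_def)
qed

text \<open>
  An infinite locally finite group contains a strictly increasing chain of finite subgroups \<open>H n\<close>, and
  the union of the chain has several ends: the function \<open>w\<close> that is \<open>1\<close> or \<open>0\<close> according to the parity of
  the first \<open>n\<close> with \<open>x \<in> H n\<close>, and \<open>0\<close> off the union, is changed in only
  finitely many places by a translation with an element of the union, although it is not constant outside any finite set. Hence right multiplication by the
  formal sum \<open>w\<close> is a homomorphism to the group ring on a left ideal that contains all \<open>1 - h\<close> with
  \<open>h\<close> in the union. If it were right multiplication by an element \<open>w'\<close> of the group ring, then \<open>w - w'\<close>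
  would be invariant under the union, hence constant on it, and \<open>w\<close> would be constant there outside the
  finite support of \<open>w'\<close>.
\<close>

lemma baer_imp_finite:
  assumes baer: "baer AG" and one: "\<one> \<noteq> \<zero>"
  shows "finite (carrier G)"
proof (rule ccontr)
  assume "infinite (carrier G)"
  then obtain H :: "nat \<Rightarrow> 'g set" where H: "\<And>n. subgroup (H n) G" and fin: "\<And>n. finite (H n)"
    and step: "\<And>n. H n \<subset> H (Suc n)"
    using G.locally_finite_chain baer_imp_locally_finite[OF baer one] by metis
  have mono: "H m \<subseteq> H n" if "m \<le> n" for m n
    using lift_Suc_mono_le[of H, OF _ that] step by blast
  have H_sub: "x \<in> carrier G" if "x \<in> H n" for x n using that H subgroup.mem_carrier by metis
  define level where "level x = (LEAST n. x \<in> H n)" for x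
  define w where "w x = (if (\<exists>n. x \<in> H n) \<and> even (level x) then \<one> else \<zero>)" for x
  have w: "w \<in> formal" using H_sub by (intro formalI) (auto simp: w_def)
  \<comment> \<open>Outside \<open>H m\<close>, a point and its translate by an element of \<open>H m\<close> lie in the same members of
      the chain.\<close>
  have w_inv: "w (inv\<^bsub>G\<^esub> h \<otimes>\<^bsub>G\<^esub> x) = w x" if h: "h \<in> H m" and x: "x \<in> carrier G" "x \<notin> H m" for h x m
  proof -
    have shift: "inv\<^bsub>G\<^esub> h \<otimes>\<^bsub>G\<^esub> x \<in> H n \<longleftrightarrow> x \<in> H n" if "h \<in> H n" for n
    proof
      assume "inv\<^bsub>G\<^esub> h \<otimes>\<^bsub>G\<^esub> x \<in> H n"
      then have "h \<otimes>\<^bsub>G\<^esub> (inv\<^bsub>G\<^esub> h \<otimes>\<^bsub>G\<^esub> x) \<in> H n" using that H subgroup.m_closed by metis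
      then show "x \<in> H n" using H_sub[OF h] x by (simp flip: G.m_assoc)
    next
      assume "x \<in> H n"
      then show "inv\<^bsub>G\<^esub> h \<otimes>\<^bsub>G\<^esub> x \<in> H n" using that H subgroup.m_closed subgroup.m_inv_closed by metis
    qed
    have "inv\<^bsub>G\<^esub> h \<otimes>\<^bsub>G\<^esub> x \<in> H n \<longleftrightarrow> x \<in> H n" for n
    proof (cases "m \<le> n")
      case True
      then show ?thesis using shift h mono by blast
    next
      case False
      then have "H n \<subseteq> H m" using mono by simp
      then show ?thesis using shift[OF h] x by blast
    qed
    then show ?thesis by (simp add: w_def level_def)
  qed
  \<comment> \<open>The largest left ideal that right multiplication by \<open>w\<close> maps into the group ring.\<close>
  define L where "L = {x \<in> carrier AG. x \<star> w \<in> carrier AG}"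
  have "left_ideal AG L"
    unfolding left_ideal_def using w
    by (auto simp: L_def zero_carrier conv_zero_left plus_carrier conv_plus_left conv_closed conv_assoc)
  moreover have "x \<star> w \<in> carrier AG" if "x \<in> L" for x using that by (simp add: L_def)
  moreover have "(x \<boxplus> y) \<star> w = x \<star> w \<boxplus> y \<star> w" if "x \<in> L" "y \<in> L" for x y
    using that w by (simp add: L_def conv_plus_left)
  moreover have "(b \<star> x) \<star> w = b \<star> (x \<star> w)" if "b \<in> carrier AG" "x \<in> L" for b x
    using that w by (simp add: L_def conv_assoc)
  ultimately obtain w' where w': "w' \<in> carrier AG" and w'_eq: "\<And>x. x \<in> L \<Longrightarrow> x \<star> w = x \<star> w'"
    using baerD[OF baer, of L "\<lambda>x. x \<star> w"] by metis
  have one_minus_L: "one_minus h \<in> L" if h: "h \<in> H m" for h m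
  proof -
    have hG: "h \<in> carrier G" using h H_sub by blast
    have "{x. (one_minus h \<star> w) x \<noteq> \<zero>} \<subseteq> H m"
    proof (rule subsetI, rule ccontr)
      fix x assume x: "x \<in> {x. (one_minus h \<star> w) x \<noteq> \<zero>}" "x \<notin> H m"
      then have "x \<in> carrier G" using conv_outside by blast
      then show False
        using x one_minus_conv[OF hG w] w_inv[OF h] w by (simp add: a_minus_def A.r_neg)
    qed
    then have "one_minus h \<star> w \<in> carrier AG"
      using fin finite_subset conv_formal[OF one_minus_carrier[OF hG] w] by (auto simp: AG_carrier)
    then show ?thesis using hG by (simp add: L_def one_minus_carrier)
  qed
  have "finite (level ` {x. w' x \<noteq> \<zero>})" using w' by (simp add: AG_carrier)
  then obtain N where N: "\<And>x. w' x \<noteq> \<zero> \<Longrightarrow> level x < N"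
    unfolding finite_nat_set_iff_bounded by auto
  have pick: "\<exists>x \<in> H (Suc n). level x = Suc n" for n
  proof -
    obtain x where x: "x \<in> H (Suc n)" "x \<notin> H n" using step by blast
    have "level x = Suc n"
      unfolding level_def
    proof (rule Least_equality)
      show "Suc n \<le> k" if "x \<in> H k" for k
        using that x mono[of k n] by (meson not_less_eq_eq subsetD)
    qed (rule x)
    then show ?thesis using x by blast
  qed
  \<comment> \<open>Two points of the union outside the support of \<open>w'\<close>, where \<open>w\<close> takes different values.\<close>
  obtain p where p: "p \<in> H (2 * N + 2)" "level p = 2 * N + 2" using pick[of "2 * N + 1"] by auto
  obtain q where q: "q \<in> H (2 * N + 1)" "level q = 2 * N + 1" using pick[of "2 * N"] by auto
  have wp: "w p = \<one>" "w q = \<zero>" using p q by (auto simp: w_def)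
  have w'p: "w' p = \<zero>" "w' q = \<zero>" using N[of p] N[of q] p q by auto
  have qH: "q \<in> H (2 * N + 2)" using q mono[of "2 * N + 1" "2 * N + 2"] by auto
  have pq: "p \<in> carrier G" "q \<in> carrier G" using p q H_sub by auto
  define h where "h = p \<otimes>\<^bsub>G\<^esub> inv\<^bsub>G\<^esub> q"
  have h: "h \<in> H (2 * N + 2)"
    unfolding h_def using p qH H subgroup.m_closed subgroup.m_inv_closed by metis
  have hp: "inv\<^bsub>G\<^esub> h \<otimes>\<^bsub>G\<^esub> p = q" using pq by (simp add: h_def G.inv_mult_group G.m_assoc)
  have hG: "h \<in> carrier G" using h H_sub by blast
  have "w p \<ominus> w q = w' p \<ominus> w' q"
    using w'_eq[OF one_minus_L[OF h]] one_minus_conv[OF hG w pq(1)] one_minus_conv[OF hG AG_carrier_formal[OF w'] pq(1)]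
    by (simp add: hp)
  then show False using one by (simp add: wp w'p a_minus_def)
qed

end

section \<open>Characterization of self-injective group rings\<close>

theorem theorem4:
  fixes A :: "('a, 'x) ring_scheme" and G :: "('g, 'y) monoid_scheme"
  assumes "ring A" and "\<one>\<^bsub>A\<^esub> \<noteq> \<zero>\<^bsub>A\<^esub>" and "group G"
  shows "left_self_injective TYPE('u) (group_ring A G) \<longleftrightarrow>
         left_self_injective TYPE('v) A \<and> finite (carrier G)"
proof -
  interpret group_ring_locale A G
    using assms by (simp add: group_ring_locale_def)
  show ?thesis
  proof
    assume "left_self_injective TYPE('u) (group_ring A G)"
    then have baer: "baer (group_ring A G)" by (rule left_self_injective_imp_baer)
    have "left_self_injective TYPE('v) A"
      unfolding left_self_injective_def
      by (rule baer_criterion[OF assms(1) baer_coefficients[OF baer]])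
    moreover have "finite (carrier G)" using baer assms(2) by (rule baer_imp_finite)
    ultimately show "left_self_injective TYPE('v) A \<and> finite (carrier G)" ..
  next
    assume *: "left_self_injective TYPE('v) A \<and> finite (carrier G)"
    then have "baer A" using left_self_injective_imp_baer by blast
    then show "left_self_injective TYPE('u) (group_ring A G)"
      unfolding left_self_injective_def using * by (intro group_ring_injective) auto
  qed
qed

end
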